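(* Let $s$ be a fixed positive integer and let $\varepsilon>0$ be a fixed (small) real number. Then for every sufficiently large prime $p$ (in terms of $s$ and $\varepsilon$) the following holds. Let $\mathcal{M}\subseteq \mathbb{F}_p^*$ be any set with $|\mathcal{M}|=\lfloor p^{14/29}\rfloor$, let $H=\lfloor p^{14/29+\varepsilon}\rfloor$ and $\mathcal{H}=\{1,2,\ldots,H\}$. Then every integer $\lambda$ can be represented in the form $$\frac{m_1}{x_1^s}+\frac{m_2}{x_2^s}+\frac{m_3}{x_3^s}\equiv \lambda \pmod p,\qquad m_i\in\mathcal{M},\ x_i\in\mathcal{H},\ i=1,2,3.$$
   Context: $\mathbb{F}_p$ is the field of residues modulo the prime $p$, identified with $\{0,1,\ldots,p-1\}$, and $\mathbb{F}_p^*=\mathbb{F}_p\setminus\{0\}$. Since $x_i<p$, each $x_i$ is invertible modulo $p$, and $m/x^s$ denotes $m\cdot (x^s)^{-1}$ in $\mathbb{F}_p$. *)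

theory Defs
  imports Complex_Main "HOL-Number_Theory.Number_Theory" "HOL-Number_Theory.Modular_Inverse"
begin

text \<open>
  The quotient \<open>m / y\<close> in the field of residues modulo a prime \<open>p\<close>, as the representative in
  \<open>{0..<p}\<close>. It is the field quotient only if \<open>y\<close> is coprime to \<open>p\<close>; otherwise it is \<open>0\<close>,
  since \<open>modular_inverse p y = 0\<close> in that case.
\<close>

definition residue_div :: "nat \<Rightarrow> int \<Rightarrow> int \<Rightarrow> int" where
  "residue_div p m y = (m * modular_inverse (int p) y) mod int p"

end

theory Submission
  imports Defs "HOL-Computational_Algebra.Polynomial" "HOL-Real_Asymp.Real_Asymp"
    "HOL-Analysis.Convex"
begin

text \<open>
  Let \<open>r\<close> be slightly larger than \<open>p powr (7/29)\<close>, let \<open>X\<close> be the set of primes \<open>x\<close> with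
  \<open>r < x \<le> r ^ 2\<close>, and let \<open>S(b)\<close> be the sum of the additive character at \<open>b * m / x ^ s\<close> over
  \<open>m \<in> M\<close> and \<open>x \<in> X\<close>. By the circle method a representation exists as soon as the maximum of
  \<open>|S(b)|\<close> over \<open>b \<noteq> 0\<close>, times the second moment of \<open>S\<close>, is less than \<open>(|M| * |X|) ^ 3\<close>. The second
  moment is essentially diagonal, since quotients of distinct primes of \<open>X\<close> are distinct modulo \<open>p\<close>
  (as \<open>r ^ 4 < p\<close>). For the maximum, Hoelder's inequality over \<open>m\<close> followed by completion bounds
  \<open>|S(b)| ^ 6\<close> by \<open>|M| ^ 5 * p * J\<close>, where \<open>J\<close> is the number of pairs of triples from \<open>X\<close> with equal
  sums of inverse \<open>s\<close>-th powers. The bound \<open>J \<le> r ^ (9 + o(1))\<close> comes from the shift \<open>y = x + u * t\<close>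
  with \<open>u \<le> r\<close> prime and \<open>t \<le> r\<close>: up to a power of \<open>u\<close>, the equation at six points \<open>x + u * t\<^sub>i\<close>
  involves only \<open>\<beta> = x / u\<close>. Unless it is degenerate, it is a nonzero polynomial equation for \<open>\<beta>\<close> of
  degree at most \<open>5 * s\<close>, and \<open>\<beta>\<close> determines \<open>(u, x)\<close>.
\<close>

section \<open>Chebyshev's lower bound for the number of primes\<close>

text \<open>
  The entries \<open>1 / (m (n choose m))\<close> of Leibniz's harmonic triangle are integer combinations of
  \<open>1/m, \<dots>, 1/n\<close>, because \<open>1 / (m (n choose m))\<close> is the difference of \<open>1 / (m ((n-1) choose m))\<close> and
  \<open>1 / ((m+1) (n choose (m+1)))\<close>.
\<close>

lemma inverse_leibniz_coefficient_Ints: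
  fixes L :: nat
  assumes "\<And>j. 1 \<le> j \<Longrightarrow> j \<le> m + k \<Longrightarrow> j dvd L" and "1 \<le> m"
  shows "real L / (real m * real ((m + k) choose m)) \<in> \<int>"
  using assms
proof (induction k arbitrary: m)
  case 0
  then have "m dvd L" by simp
  then obtain c where "L = m * c" by (elim dvdE)
  with 0 show ?case by simp
next
  case (Suc k)
  have 1: "real L / (real m * real ((m + k) choose m)) \<in> \<int>"
    using Suc.prems by (intro Suc.IH) auto
  have 2: "real L / (real (Suc m) * real ((Suc m + k) choose Suc m)) \<in> \<int>"
    using Suc.prems by (intro Suc.IH) auto
  have pos: "(fact k :: real) > 0" "(fact m :: real) > 0" "(fact (m + k) :: real) > 0" by simp_all
  have b1: "real ((m + k) choose m) = fact (m + k) / (fact m * fact k)"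
    by (simp add: binomial_fact)
  have b2: "real ((Suc m + k) choose Suc m) = (real m + real k + 1) * fact (m + k) / ((real m + 1) * fact m * fact k)"
    by (subst binomial_fact) (simp_all add: algebra_simps)
  have b3: "real ((m + Suc k) choose m) = (real m + real k + 1) * fact (m + k) / (fact m * ((real k + 1) * fact k))"
    by (subst binomial_fact) (simp_all add: algebra_simps)
  have "real L / (real m * real ((m + Suc k) choose m)) =
      real L / (real m * real ((m + k) choose m)) - real L / (real (Suc m) * real ((Suc m + k) choose Suc m))"
    unfolding b1 b2 b3 using pos Suc.prems(2)
    by (simp add: divide_simps) (simp add: algebra_simps)
  with Ints_diff[OF 1 2] show ?case by simp
qed

definition prime_count :: "nat \<Rightarrow> nat" where
  "prime_count n = card {q. prime q \<and> q \<le> n}"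

lemma finite_primes_le [simp]: "finite {q::nat. prime q \<and> q \<le> n}"
  by (rule finite_subset[of _ "{..n}"]) auto

text \<open>\<open>L\<close> is the least common multiple of 1, ..., \<open>n\<close>, built as the
  product of the largest prime powers not exceeding \<open>n\<close>. Each of the
  \<open>prime_count n\<close> factors is at most \<open>n\<close>.\<close>

lemma common_multiple_le_power_prime_count:
  assumes "n > 0"
  obtains L where "L > 0" "L \<le> n ^ prime_count n" "\<And>j. 1 \<le> j \<Longrightarrow> j \<le> n \<Longrightarrow> j dvd L"
proof -
  define e where "e = (\<lambda>q. Max {e. q ^ e \<le> n})"
  define L where "L = (\<Prod>q | prime q \<and> q \<le> n. q ^ e q)"
  have fin: "finite {e. q ^ e \<le> n}" if "prime q" for q
  proof (rule finite_subset[of _ "{..n}"])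
    show "{e. q ^ e \<le> n} \<subseteq> {..n}"
    proof safe
      fix e assume "q ^ e \<le> n"
      moreover have "e < q ^ e" using prime_gt_1_nat[OF that] by (simp add: power_gt_expt)
      ultimately show "e \<le> n" by linarith
    qed
  qed simp
  have le: "q ^ e q \<le> n" if "prime q" for q
  proof -
    have "e q \<in> {e. q ^ e \<le> n}"
      unfolding e_def using fin[OF that] assms by (intro Max_in) (auto intro!: exI[of _ 0])
    then show ?thesis by simp
  qed
  have "L > 0"
    unfolding L_def by (auto intro!: prod_pos dest: prime_gt_0_nat)
  moreover have "L \<le> n ^ prime_count n"
    unfolding L_def prime_count_def using le by (subst prod_constant[symmetric], intro prod_mono) auto
  moreover have "j dvd L" if j: "1 \<le> j" "j \<le> n" for j
  proof -
    have "j = (\<Prod>q\<in>prime_factors j. q ^ multiplicity q j)"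
      using j by (simp add: prod_prime_factors)
    also have "\<dots> dvd (\<Prod>q\<in>prime_factors j. q ^ e q)"
    proof (intro prod_dvd_prod le_imp_power_dvd)
      fix q assume q: "q \<in> prime_factors j"
      then have "q ^ multiplicity q j \<le> n"
        using j dvd_imp_le[OF multiplicity_dvd[of q j]] by linarith
      with q fin[of q] show "multiplicity q j \<le> e q"
        unfolding e_def by (intro Max_ge) auto
    qed
    also have "\<dots> dvd L"
      unfolding L_def using j
      by (intro prod_dvd_prod_subset) (auto dest!: dvd_imp_le)
    finally show ?thesis .
  qed
  ultimately show ?thesis by (rule that)
qed

text \<open>For the common multiple \<open>L\<close> of 1, ..., \<open>2 * k\<close>, the quotient
  of \<open>L\<close> by \<open>k * ((2 * k) choose k)\<close> is a positive integer, hence at least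
  1, while the central binomial coefficient is at least \<open>4 ^ k / (2 * k)\<close>.\<close>

lemma four_power_le_power_prime_count:
  assumes "k > 0"
  shows "4 ^ k \<le> 2 * (2 * k) ^ prime_count (2 * k)"
proof -
  obtain L where L: "L > 0" "L \<le> (2 * k) ^ prime_count (2 * k)"
    "\<And>j. 1 \<le> j \<Longrightarrow> j \<le> 2 * k \<Longrightarrow> j dvd L"
    using common_multiple_le_power_prime_count[of "2 * k"] assms by auto
  define B where "B = real k * real ((2 * k) choose k)"
  have "real L / B \<in> \<int>"
    using inverse_leibniz_coefficient_Ints[of k k L] L(3) assms by (simp add: mult_2 B_def)
  then obtain i :: int where i: "real L / B = of_int i" by (elim Ints_cases)
  have B: "B > 0" using assms by (simp add: B_def)
  have "real L / B > 0" using B L(1) by simp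
  then have "i \<ge> 1" unfolding i by linarith
  then have "real L / B \<ge> 1" unfolding i by simp
  then have "B \<le> real L" using B by (simp add: field_simps)
  moreover have "4 ^ k \<le> 2 * B"
    using central_binomial_lower_bound[OF assms] assms unfolding B_def by (simp add: field_simps)
  ultimately have "4 ^ k \<le> 2 * real L" by linarith
  also have "\<dots> \<le> 2 * real ((2 * k) ^ prime_count (2 * k))"
    using L(2) by (simp only: of_nat_le_iff mult_le_cancel_left_pos zero_less_numeral)
  finally have "real (4 ^ k) \<le> real (2 * (2 * k) ^ prime_count (2 * k))" by simp
  then show ?thesis by (simp only: of_nat_le_iff)
qed

lemma prime_count_mono: "m \<le> n \<Longrightarrow> prime_count m \<le> prime_count n"
  unfolding prime_count_def by (intro card_mono) auto

text \<open>Logarithms of the previous bound with \<open>k = n div 2\<close> give a lower bound of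
  order \<open>n / ln n\<close>, which beats every power of \<open>n\<close> with exponent below
  1.\<close>

lemma prime_count_ge_powr:
  assumes "\<delta> > 0"
  shows "eventually (\<lambda>n. real (prime_count n) \<ge> real n powr (1 - \<delta>)) sequentially"
proof -
  have "eventually (\<lambda>n. (real n - 1) / 2 * ln 4 - ln 2 \<ge> real n powr (1 - \<delta>) * ln (real n)) sequentially"
    using assms by real_asymp
  then show ?thesis
    using eventually_ge_at_top[of 2]
  proof eventually_elim
    case (elim n)
    define k where "k = n div 2"
    have k: "k > 0" "2 * k \<le> n" "real k \<ge> (real n - 1) / 2"
    proof -
      have "n \<le> 2 * k + 1" unfolding k_def by linarith
      then have "real n \<le> real (2 * k + 1)" by (simp only: of_nat_le_iff)
      then show "real k \<ge> (real n - 1) / 2" by simp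
    qed (use elim(2) in \<open>auto simp: k_def\<close>)
    have "real (4 ^ k) \<le> real (2 * (2 * k) ^ prime_count (2 * k))"
      using four_power_le_power_prime_count[OF k(1)] by (simp only: of_nat_le_iff)
    then have "ln (4 ^ k) \<le> ln (2 * real (2 * k) ^ prime_count (2 * k))"
      using k(1) by (subst ln_le_cancel_iff) simp_all
    also have "\<dots> = ln 2 + real (prime_count (2 * k)) * ln (real (2 * k))"
      using k(1) by (simp add: ln_mult ln_realpow ring_distribs)
    also have "\<dots> \<le> ln 2 + real (prime_count n) * ln (real n)"
      using k prime_count_mono[OF k(2)] by (intro add_left_mono mult_mono) auto
    finally have "real k * ln 4 - ln 2 \<le> real (prime_count n) * ln (real n)"
      by (simp add: ln_realpow)
    moreover have "(real n - 1) / 2 * ln 4 \<le> real k * ln 4"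
      using k by (intro mult_right_mono) auto
    ultimately have "real n powr (1 - \<delta>) * ln (real n) \<le> real (prime_count n) * ln (real n)"
      using elim(1) by linarith
    then show ?case using elim(2) by simp
  qed
qed

section \<open>Roots of polynomials modulo a prime\<close>

text \<open>Lagrange's bound, splitting off a linear factor for each root. That \<open>f\<close> is
  not the zero polynomial modulo \<open>p\<close> is certified by a single value at
  \<open>b\<close>, which is what the applications can compute.\<close>

lemma card_roots_mod_prime_le_degree:
  fixes f :: "int poly" and p :: int
  assumes "prime p" and "\<not> p dvd poly f b" and "finite R"
    and "\<And>x. x \<in> R \<Longrightarrow> p dvd poly f x"
    and "\<And>x y. x \<in> R \<Longrightarrow> y \<in> R \<Longrightarrow> [x = y] (mod p) \<Longrightarrow> x = y"
  shows "card R \<le> degree f"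
  using assms(2-)
proof (induction "degree f" arbitrary: f R)
  case 0
  then obtain c where "f = [:c:]" by (metis degree_eq_zeroE)
  with 0 have "R = {}" by auto
  then show ?case by simp
next
  case (Suc d)
  show ?case
  proof (cases "R = {}")
    case False
    then obtain a where a: "a \<in> R" by blast
    define g where "g = synthetic_div f a"
    have f: "poly f x = (x - a) * poly g x + poly f a" for x
      using arg_cong[OF synthetic_div_correct'[of a f], of "\<lambda>h. poly h x"] unfolding g_def
      by (simp add: algebra_simps)
    have pa: "p dvd poly f a" using Suc.prems a by blast
    have "card (R - {a}) \<le> degree g"
    proof (rule Suc.hyps(1))
      show "d = degree g" using Suc.hyps(2) unfolding g_def by (simp add: degree_synthetic_div)
      \<comment> \<open>The remainder \<open>poly f a\<close> is 0 modulo \<open>p\<close>, so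
        nonvanishing at the same point \<open>b\<close> passes to the quotient.\<close>
      show "\<not> p dvd poly g b"
        using Suc.prems(1) f[of b] pa by (metis dvd_add dvd_mult)
      show "p dvd poly g x" if "x \<in> R - {a}" for x
      proof -
        have "p dvd (x - a) * poly g x"
          using Suc.prems(3)[of x] f[of x] pa that by (metis DiffD1 dvd_add_left_iff)
        moreover have "\<not> p dvd x - a"
          using Suc.prems(4)[of x a] that a by (auto simp: cong_iff_dvd_diff)
        ultimately show ?thesis using assms(1) by (simp add: prime_dvd_mult_iff)
      qed
    qed (use Suc.prems in auto)
    then show ?thesis
      using Suc.prems(2) a Suc.hyps(2) unfolding g_def by (simp add: degree_synthetic_div)
  qed simp
qed

lemma card_le_degree_mod_prime:
  fixes f :: "int poly" and p :: int and h :: "'a \<Rightarrow> int"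
  assumes "prime p" and "\<not> p dvd poly f b" and "finite A"
    and "\<And>x. x \<in> A \<Longrightarrow> p dvd poly f (h x)"
    and "\<And>x y. x \<in> A \<Longrightarrow> y \<in> A \<Longrightarrow> [h x = h y] (mod p) \<Longrightarrow> x = y"
  shows "card A \<le> degree f"
proof -
  have "inj_on h A" using assms(5) by (auto intro!: inj_onI)
  then have "card A = card (h ` A)" by (simp add: card_image)
  also have "\<dots> \<le> degree f"
    by (rule card_roots_mod_prime_le_degree[OF assms(1,2)]) (use assms(3-5) in auto)
  finally show ?thesis .
qed

section \<open>Exponential sums modulo p\<close>

text \<open>Jensen's inequality for the convex even power \<open>n + 2\<close>. The double successor
  keeps both exponents positive, so that an empty or infinite \<open>I\<close> gives 0 on both
  sides.\<close>

lemma power_sum_le_card_power: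
  fixes f :: "'a \<Rightarrow> real"
  assumes "even n"
  shows "(\<Sum>i\<in>I. f i) ^ Suc (Suc n) \<le> real (card I) ^ Suc n * (\<Sum>i\<in>I. f i ^ Suc (Suc n))"
proof (cases "finite I \<and> I \<noteq> {}")
  case True
  define c where "c = real (card I)"
  have c: "c > 0" using True by (simp add: c_def card_gt_0_iff)
  have "(\<Sum>i\<in>I. (1 / c) *\<^sub>R f i) ^ Suc (Suc n) \<le> (\<Sum>i\<in>I. (1 / c) * f i ^ Suc (Suc n))"
    using True assms c
    by (intro convex_on_sum[OF _ _ convex_power_even]) (auto simp: c_def)
  then have "((\<Sum>i\<in>I. f i) / c) ^ Suc (Suc n) \<le> (\<Sum>i\<in>I. f i ^ Suc (Suc n)) / c"
    by (simp add: sum_divide_distrib)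
  then show ?thesis using c unfolding c_def[symmetric]
    by (simp add: power_divide divide_simps mult_ac)
qed (auto simp del: power_Suc)

section \<open>Additive characters modulo p and moments of exponential sums\<close>

definition add_char :: "nat \<Rightarrow> int \<Rightarrow> complex" where
  "add_char p k = cis (2 * pi * of_int k / real p)"

lemma add_char_add: "add_char p (j + k) = add_char p j * add_char p k"
  by (simp add: add_char_def cis_mult ring_distribs add_divide_distrib)

lemma add_char_uminus: "add_char p (- k) = cnj (add_char p k)"
  by (simp add: add_char_def cis_cnj)

lemma add_char_0 [simp]: "add_char p 0 = 1"
  by (simp add: add_char_def)

lemma norm_add_char [simp]: "norm (add_char p k) = 1"
  by (simp add: add_char_def)

lemma add_char_eq_1_iff:
  assumes "p > 0"
  shows "add_char p k = 1 \<longleftrightarrow> int p dvd k"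
proof -
  have "add_char p k = 1 \<longleftrightarrow> cos (2 * pi * of_int k / real p) = 1"
    by (auto simp: add_char_def complex_eq_iff cos_one_sin_zero)
  also have "\<dots> \<longleftrightarrow> (\<exists>m::int. 2 * pi * of_int k / real p = of_int m * 2 * pi)"
    by (rule cos_one_2pi_int)
  also have "\<dots> \<longleftrightarrow> (\<exists>m::int. real_of_int k = of_int (m * int p))"
    using assms by (simp add: field_simps)
  also have "\<dots> \<longleftrightarrow> int p dvd k"
    unfolding of_int_eq_iff by (auto simp: dvd_def mult.commute)
  finally show ?thesis .
qed

lemma add_char_cong:
  assumes "p > 0" "[j = k] (mod int p)"
  shows "add_char p j = add_char p k"
proof -
  have "add_char p (j - k) = 1"
    using assms by (simp add: add_char_eq_1_iff cong_iff_dvd_diff)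
  then show ?thesis using add_char_add[of p "j - k" k] by simp
qed

lemma add_char_power: "add_char p k ^ n = add_char p (int n * k)"
  by (induction n) (simp_all add: add_char_add ring_distribs)

text \<open>Orthogonality: a geometric series whose ratio is a \<open>p\<close>-th root of unity,
  equal to 1 exactly when \<open>p\<close> divides \<open>k\<close>.\<close>

lemma sum_add_char:
  assumes "p > 0"
  shows "(\<Sum>b\<in>{0..<int p}. add_char p (b * k)) = (if int p dvd k then of_nat p else 0)"
proof -
  have "(\<Sum>b\<in>{0..<int p}. add_char p (b * k)) = (\<Sum>n<p. add_char p k ^ n)"
    by (rule sum.reindex_bij_witness[of _ int nat]) (auto simp: add_char_power)
  also have "\<dots> = (if int p dvd k then of_nat p else 0)"
  proof (cases "int p dvd k")
    case True
    then show ?thesis using add_char_eq_1_iff[OF assms, of k] by simp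
  next
    case False
    moreover have "add_char p k ^ p = 1"
      unfolding add_char_power using assms by (simp add: add_char_eq_1_iff)
    ultimately show ?thesis using add_char_eq_1_iff[OF assms, of k]
      by (simp add: geometric_sum)
  qed
  finally show ?thesis .
qed

lemma sum_add_char_eq_card:
  assumes "p > 0" "finite Z"
  shows "(\<Sum>b\<in>{0..<int p}. \<Sum>z\<in>Z. add_char p (b * g z)) = of_nat (p * card {z\<in>Z. int p dvd g z})"
proof -
  have "(\<Sum>b\<in>{0..<int p}. \<Sum>z\<in>Z. add_char p (b * g z)) = (\<Sum>z\<in>Z. if int p dvd g z then of_nat p else 0)"
    by (subst sum.swap) (simp add: sum_add_char assms)
  also have "\<dots> = of_nat (p * card {z\<in>Z. int p dvd g z})"
    using assms by (simp add: sum.If_cases Int_def mult.commute)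
  finally show ?thesis .
qed

text \<open>With \<open>sum3 h\<close> in place of \<open>g\<close>, on triples, this is the usual
  six-variable additive energy of \<open>h\<close>.\<close>

definition energy :: "nat \<Rightarrow> ('a \<Rightarrow> int) \<Rightarrow> 'a set \<Rightarrow> nat" where
  "energy p g Z = card {(z, z') \<in> Z \<times> Z. [g z = g z'] (mod int p)}"

text \<open>Parseval: the squared norm expands into a sum over pairs at \<open>g z - g z'\<close>,
  and orthogonality keeps the pairs that collide modulo \<open>p\<close>.\<close>

lemma sum_norm_square_exp_sum:
  assumes "p > 0" "finite Z"
  shows "(\<Sum>b\<in>{0..<int p}. norm (\<Sum>z\<in>Z. add_char p (b * g z)) ^ 2) = real (p * energy p g Z)"
proof -
  have "complex_of_real (norm (\<Sum>z\<in>Z. add_char p (b * g z)) ^ 2) =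
      (\<Sum>w\<in>Z \<times> Z. add_char p (b * (g (fst w) - g (snd w))))" for b
  proof -
    have "complex_of_real (norm (\<Sum>z\<in>Z. add_char p (b * g z)) ^ 2) =
        (\<Sum>z\<in>Z. add_char p (b * g z)) * (\<Sum>z\<in>Z. add_char p (- (b * g z)))"
      unfolding complex_norm_square cnj_sum add_char_uminus ..
    also have "\<dots> = (\<Sum>w\<in>Z \<times> Z. add_char p (b * (g (fst w) - g (snd w))))"
      by (simp add: sum_product sum.cartesian_product case_prod_unfold right_diff_distrib
          flip: add_char_add)
    finally show ?thesis .
  qed
  then have "complex_of_real (\<Sum>b\<in>{0..<int p}. norm (\<Sum>z\<in>Z. add_char p (b * g z)) ^ 2) =
      (\<Sum>b\<in>{0..<int p}. \<Sum>w\<in>Z \<times> Z. add_char p (b * (g (fst w) - g (snd w))))"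
    by (simp only: of_real_sum)
  also have "\<dots> = of_nat (p * energy p g Z)"
    by (subst sum_add_char_eq_card)
      (use assms in \<open>auto simp: energy_def cong_iff_dvd_diff intro!: arg_cong[where f = card]\<close>)
  also have "\<dots> = complex_of_real (real (p * energy p g Z))" by (simp only: of_real_of_nat_eq)
  finally show ?thesis by (simp only: of_real_eq_iff)
qed

definition sum3 :: "('a \<Rightarrow> 'b) \<Rightarrow> 'a \<times> 'a \<times> 'a \<Rightarrow> 'b::comm_monoid_add" where
  "sum3 g = (\<lambda>(a, b, c). g a + g b + g c)"

lemma exp_sum_cube:
  "(\<Sum>z\<in>Z. add_char p (b * g z)) ^ 3 = (\<Sum>w\<in>Z \<times> Z \<times> Z. add_char p (b * sum3 g w))"
proof -
  let ?f = "\<lambda>z. add_char p (b * g z)"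
  have "(\<Sum>z\<in>Z. ?f z) ^ 3 = (\<Sum>z\<in>Z. ?f z) * ((\<Sum>z\<in>Z. ?f z) * (\<Sum>z\<in>Z. ?f z))"
    by (simp add: power3_eq_cube)
  also have "\<dots> = (\<Sum>w\<in>Z \<times> Z \<times> Z. ?f (fst w) * (?f (fst (snd w)) * ?f (snd (snd w))))"
    by (simp only: sum_product sum.cartesian_product case_prod_unfold)
  also have "\<dots> = (\<Sum>w\<in>Z \<times> Z \<times> Z. add_char p (b * sum3 g w))"
    by (simp add: sum3_def case_prod_unfold ring_distribs add_char_add mult.assoc)
  finally show ?thesis .
qed

text \<open>The sixth moment of a sum is the second moment of its cube, and the cube is itself an
  exponential sum over triples.\<close>

lemma sum_norm_power6_exp_sum:
  assumes "p > 0" "finite Z"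
  shows "(\<Sum>b\<in>{0..<int p}. norm (\<Sum>z\<in>Z. add_char p (b * g z)) ^ 6) =
    real (p * energy p (sum3 g) (Z \<times> Z \<times> Z))"
proof -
  have "norm (\<Sum>z\<in>Z. add_char p (b * g z)) ^ 6 =
      norm (\<Sum>w\<in>Z \<times> Z \<times> Z. add_char p (b * sum3 g w)) ^ 2" for b
    unfolding exp_sum_cube[symmetric] norm_power power_mult[symmetric] by simp
  then show ?thesis using assms by (simp add: sum_norm_square_exp_sum)
qed

section \<open>Energies of inverse powers\<close>

definition inv_pow :: "nat \<Rightarrow> nat \<Rightarrow> int \<Rightarrow> int" where
  "inv_pow p s x = modular_inverse (int p) (x ^ s)"

lemma coprime_prime_int_iff:
  assumes "prime p"
  shows "coprime x (int p) \<longleftrightarrow> \<not> int p dvd x"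
  using assms prime_imp_coprime[of "int p" x]
  by (auto simp: coprime_commute dest: coprime_common_divisor_int[of x "int p" "int p"] prime_gt_1_nat)

lemma prime_int_dvd_power:
  assumes "prime p" "int p dvd x ^ n"
  shows "int p dvd x"
  using assms prime_dvd_power[of "int p" x n] by simp

lemma cong_inv_pow:
  assumes "prime p" "\<not> int p dvd x"
  shows "[x ^ s * inv_pow p s x = 1] (mod int p)"
  unfolding inv_pow_def using assms
  by (intro cong_modular_inverse1) (simp add: coprime_prime_int_iff)

lemma cong_cancel_prime:
  assumes "prime p" "\<not> int p dvd k" "[a * k = b * k] (mod int p)"
  shows "[a = b] (mod int p)"
  using assms cong_mult_rcancel[of k "int p"] by (simp add: coprime_prime_int_iff)

lemma cong_imp_eq_of_abs_less:
  fixes a b :: int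
  assumes "[a = b] (mod int p)" "\<bar>a - b\<bar> < int p"
  shows "a = b"
  using assms zdvd_imp_le[of "int p" "\<bar>a - b\<bar>"] by (auto simp: cong_iff_dvd_diff)

text \<open>If \<open>x = x'\<close> then \<open>m = m'\<close>, which gives the diagonal term. If
  \<open>x\<close> and \<open>x'\<close> differ, then \<open>x' / x\<close> is a root of
  \<open>m * T ^ s - m'\<close> modulo \<open>p\<close>. Since products of two elements of
  \<open>X\<close> are below \<open>p\<close>, this ratio determines the pair of primes, so each
  \<open>(m, m')\<close> contributes at most \<open>s\<close>.\<close>

lemma energy_prime_quotients_le:
  assumes p: "prime p" and s: "s > 0" and M: "M \<subseteq> {1..<int p}"
    and X: "finite X" "\<And>x. x \<in> X \<Longrightarrow> prime x" "\<And>x y. x \<in> X \<Longrightarrow> y \<in> X \<Longrightarrow> x * y < int p"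
  shows "energy p (\<lambda>(m, x). m * inv_pow p s x) (M \<times> X) \<le> card M * card X + s * card M ^ 2"
proof -
  have pi: "prime (int p)" using p by simp
  have finM: "finite M" using M finite_subset by blast
  have Mp: "\<not> int p dvd m" if "m \<in> M" for m
    using M that zdvd_imp_le[of "int p" m] by auto
  have Xpos: "x > 1" if "x \<in> X" for x using X(2)[OF that] prime_gt_1_int by simp
  have Xp: "\<not> int p dvd x" if "x \<in> X" for x
  proof
    assume "int p dvd x"
    then have "int p \<le> x" using Xpos[OF that] by (intro zdvd_imp_le) auto
    moreover have "x * 1 \<le> x * x" using Xpos[OF that] by (intro mult_left_mono) auto
    ultimately show False using X(3)[OF that that] by simp
  qed
  define Q where "Q = (\<lambda>(m, m'). {(x, x') \<in> X \<times> X. x \<noteq> x' \<and> [m * x' ^ s = m' * x ^ s] (mod int p)})"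
  define S1 where "S1 = (\<lambda>w. (w, w)) ` (M \<times> X)"
  define S2 where "S2 = (\<Union>w\<in>M \<times> M. (\<lambda>(x, x'). ((fst w, x), (snd w, x'))) ` Q w)"
  have Qcard: "card (Q w) \<le> s" if w: "w \<in> M \<times> M" for w
  proof -
    obtain m m' where mm: "w = (m, m')" "m \<in> M" "m' \<in> M" using w by auto
    \<comment> \<open>Its value at 0 is \<open>- m'\<close>, nonzero modulo \<open>p\<close>,
      because \<open>s > 0\<close>.\<close>
    define f where "f = monom m s - [:m':]"
    define h where "h = (\<lambda>(x, x'). x' * modular_inverse (int p) x)"
    have "card (Q w) \<le> degree f"
    proof (rule card_le_degree_mod_prime[OF pi, where b = 0 and h = h])
      show "\<not> int p dvd poly f 0"
        using Mp[OF mm(3)] s by (simp add: f_def poly_monom zero_power)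
      show "finite (Q w)"
        by (rule finite_subset[of _ "X \<times> X"]) (use X(1) in \<open>auto simp: Q_def mm(1)\<close>)
    next
      fix w' assume w': "w' \<in> Q w"
      then obtain x x' where xx: "w' = (x, x')" "x \<in> X" "x' \<in> X" "[m * x' ^ s = m' * x ^ s] (mod int p)"
        by (auto simp: Q_def mm(1))
      have x1: "[x * modular_inverse (int p) x = 1] (mod int p)"
        using Xp[OF xx(2)] p by (intro cong_modular_inverse1) (simp add: coprime_prime_int_iff)
      have "[m * (x' * modular_inverse (int p) x) ^ s * x ^ s = m * x' ^ s * (x * modular_inverse (int p) x) ^ s] (mod int p)"
        by (simp add: power_mult_distrib mult_ac)
      also have "[m * x' ^ s * (x * modular_inverse (int p) x) ^ s = m' * x ^ s * 1 ^ s] (mod int p)"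
        by (intro cong_mult cong_pow xx x1)
      finally have "[m * (x' * modular_inverse (int p) x) ^ s = m'] (mod int p)"
        using cong_cancel_prime[OF p, of "x ^ s"] Xp[OF xx(2)] pi by (auto dest: prime_int_dvd_power[OF p])
      then show "int p dvd poly f (h w')"
        by (simp add: f_def h_def xx poly_monom cong_iff_dvd_diff)
    next
      fix v w' assume "v \<in> Q w" "w' \<in> Q w" and vw: "[h v = h w'] (mod int p)"
      then obtain x x' y y' where v: "v = (x, x')" "x \<in> X" "x' \<in> X" "x \<noteq> x'"
        and w': "w' = (y, y')" "y \<in> X" "y' \<in> X" "y \<noteq> y'"
        by (auto simp: Q_def mm(1))
      have x1: "[x * modular_inverse (int p) x = 1] (mod int p)" "[y * modular_inverse (int p) y = 1] (mod int p)"
        using Xp[OF v(2)] Xp[OF w'(2)] p by (auto intro!: cong_modular_inverse1 simp: coprime_prime_int_iff)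
      have "[x' * y * 1 = x' * y * (x * modular_inverse (int p) x)] (mod int p)"
        by (intro cong_mult cong_refl cong_sym[OF x1(1)])
      also have "x' * y * (x * modular_inverse (int p) x) = h v * (x * y)"
        by (simp add: h_def v mult_ac)
      also have "[h v * (x * y) = h w' * (x * y)] (mod int p)"
        by (intro cong_mult cong_refl vw)
      also have "h w' * (x * y) = y' * x * (y * modular_inverse (int p) y)"
        by (simp add: h_def w' mult_ac)
      also have "[y' * x * (y * modular_inverse (int p) y) = y' * x * 1] (mod int p)"
        by (intro cong_mult cong_refl x1)
      finally have c: "[x' * y = y' * x] (mod int p)" by simp
      have "0 < x' * y" "0 < y' * x" "x' * y < int p" "y' * x < int p"
        using Xpos X(3) v w' by (force intro!: mult_pos_pos)+
      then have "x' * y = y' * x" by (intro cong_imp_eq_of_abs_less[OF c]) linarith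
      \<comment> \<open>The congruence of ratios is now an equality of integers. The prime
        \<open>x\<close> differs from the prime \<open>x'\<close>, so it must divide
        \<open>y\<close>.\<close>
      then have "x dvd x' * y" by simp
      then have "x = y"
        using X(2) v w' by (metis prime_dvd_mult_iff primes_dvd_imp_eq)
      with \<open>x' * y = y' * x\<close> Xpos[OF v(2)] show "v = w'" by (simp add: v w')
    qed
    also have "degree f \<le> s"
      unfolding f_def by (intro degree_diff_le degree_monom_le) simp
    finally show ?thesis .
  qed
  have "{(z, z') \<in> (M \<times> X) \<times> (M \<times> X). [(\<lambda>(m, x). m * inv_pow p s x) z = (\<lambda>(m, x). m * inv_pow p s x) z'] (mod int p)} \<subseteq> S1 \<union> S2"
  proof safe
    fix m x m' x'
    assume *: "m \<in> M" "x \<in> X" "m' \<in> M" "x' \<in> X" "((m, x), m', x') \<notin> S2"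
      and c: "[m * inv_pow p s x = m' * inv_pow p s x'] (mod int p)"
    have "[m * x' ^ s * 1 = m * x' ^ s * (x ^ s * inv_pow p s x)] (mod int p)"
      by (intro cong_mult cong_refl cong_sym[OF cong_inv_pow[OF p Xp]] *)
    also have "m * x' ^ s * (x ^ s * inv_pow p s x) = m * inv_pow p s x * (x ^ s * x' ^ s)"
      by (simp add: mult_ac)
    also have "[\<dots> = m' * inv_pow p s x' * (x ^ s * x' ^ s)] (mod int p)"
      by (intro cong_mult cong_refl c)
    also have "m' * inv_pow p s x' * (x ^ s * x' ^ s) = m' * x ^ s * (x' ^ s * inv_pow p s x')"
      by (simp add: mult_ac)
    also have "[\<dots> = m' * x ^ s * 1] (mod int p)"
      by (intro cong_mult cong_refl cong_inv_pow[OF p Xp] *)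
    finally have c': "[m * x' ^ s = m' * x ^ s] (mod int p)" by simp
    show "((m, x), m', x') \<in> S1"
    proof (cases "x = x'")
      case True
      then have "[m = m'] (mod int p)"
        using cong_cancel_prime[OF p, of "x ^ s"] c' Xp[OF *(2)] pi by (auto dest: prime_int_dvd_power[OF p])
      moreover have "m \<in> {1..<int p}" "m' \<in> {1..<int p}" using * M by auto
      then have "\<bar>m - m'\<bar> < int p" by auto
      ultimately have "m = m'" by (rule cong_imp_eq_of_abs_less)
      with True * show ?thesis by (auto simp: S1_def)
    next
      case False
      then have "(x, x') \<in> Q (m, m')" using c' * by (simp add: Q_def)
      then have "((m, x), m', x') \<in> S2" using * unfolding S2_def by force
      with * show ?thesis by simp
    qed
  qed
  moreover have fin: "finite S1" "finite S2"
    using finM X(1) by (auto simp: S1_def S2_def Q_def intro!: finite_imageI)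
      (auto intro: finite_subset[of _ "X \<times> X"])
  ultimately have "energy p (\<lambda>(m, x). m * inv_pow p s x) (M \<times> X) \<le> card (S1 \<union> S2)"
    unfolding energy_def by (intro card_mono) (auto simp: case_prod_unfold)
  also have "\<dots> \<le> card S1 + card S2" by (rule card_Un_le)
  also have "card S1 \<le> card M * card X"
    unfolding S1_def using card_image_le[of "M \<times> X"] finM X(1) by (simp add: card_cartesian_product)
  also have "card S2 \<le> (\<Sum>w\<in>M \<times> M. s)"
    unfolding S2_def
  proof (rule order_trans[OF card_UN_le sum_mono])
    fix w assume "w \<in> M \<times> M"
    moreover have "finite (Q w)"
      by (rule finite_subset[of _ "X \<times> X"]) (use X(1) in \<open>auto simp: Q_def\<close>)
    ultimately show "card ((\<lambda>(x, x'). ((fst w, x), (snd w, x'))) ` Q w) \<le> s"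
      using card_image_le Qcard order_trans by meson
  qed (use finM in auto)
  finally show ?thesis
    by (simp add: card_cartesian_product power2_eq_square mult_ac)
qed

section \<open>Sums of three inverse powers of primes, by shifting\<close>

definition set3 :: "'a \<times> 'a \<times> 'a \<Rightarrow> 'a set" where
  "set3 = (\<lambda>(a, b, c). {a, b, c})"

text \<open>With \<open>\<beta> = x / u\<close>, the power \<open>(x + u * v) ^ s\<close> is
  \<open>u ^ s * (\<beta> + v) ^ s\<close> modulo \<open>p\<close>, so a power of \<open>u\<close>
  cancels from the equation \<open>sol\<close>. Clearing denominators over the at most six points of
  \<open>V\<close> leaves a polynomial of degree at most \<open>5 * s\<close> in
  \<open>\<beta>\<close>, and by \<open>inj\<close> the root \<open>\<beta>\<close> determines
  \<open>(u, x)\<close>.\<close>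

lemma card_shifted_solutions_le:
  fixes A :: "(int \<times> int) set" and z z' :: "int \<times> int \<times> int"
  defines "V \<equiv> set3 z \<union> set3 z'"
  assumes p: "prime p" "p > 3" and s: "s > 0" and A: "finite A"
    and nondeg: "\<not> set3 z' \<subseteq> set3 z"
    and V: "\<And>v w. v \<in> V \<Longrightarrow> w \<in> V \<Longrightarrow> [v = w] (mod int p) \<Longrightarrow> v = w"
    and u: "\<And>u x. (u, x) \<in> A \<Longrightarrow> \<not> int p dvd u"
    and cop: "\<And>u x v. (u, x) \<in> A \<Longrightarrow> v \<in> V \<Longrightarrow> \<not> int p dvd x + u * v"
    and sol: "\<And>u x. (u, x) \<in> A \<Longrightarrow>
      [sum3 (\<lambda>v. inv_pow p s (x + u * v)) z = sum3 (\<lambda>v. inv_pow p s (x + u * v)) z'] (mod int p)"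
    and inj: "\<And>u x u' x'. (u, x) \<in> A \<Longrightarrow> (u', x') \<in> A \<Longrightarrow> [x * u' = x' * u] (mod int p) \<Longrightarrow> (u, x) = (u', x')"
  shows "card A \<le> 5 * s"
proof -
  have pi: "prime (int p)" using p by simp
  obtain t1 t2 t3 t4 t5 t6 where z: "z = (t1, t2, t3)" "z' = (t4, t5, t6)"
    by (metis prod_cases3)
  have V_eq: "V = {t1, t2, t3, t4, t5, t6}" by (auto simp: V_def z set3_def)
  have finV: "finite V" by (simp add: V_eq)
  have cardV: "card (V - {v}) \<le> 5" if "v \<in> V" for v
  proof -
    have "card V \<le> card (set [t1, t2, t3, t4, t5, t6])" by (simp add: V_eq)
    also have "\<dots> \<le> 6" by (rule order_trans[OF card_length]) simp
    finally show ?thesis using that finV by simp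
  qed
  \<comment> \<open>The equation for \<open>\<beta> = x / u\<close>, multiplied by the product of all \<open>(\<beta> + w)\<^sup>s\<close>. Since only one
    sign occurs at \<open>b\<close>, the terms not vanishing at \<open>- b\<close> cannot cancel.\<close>
  define q where "q = (\<lambda>v. \<Prod>w\<in>V - {v}. [:w, 1:] ^ s)"
  define f where "f = sum3 q z - sum3 q z'"
  have deg_q: "degree (q v) \<le> 5 * s" if "v \<in> V" for v
  proof -
    have "degree (q v) \<le> (\<Sum>w\<in>V - {v}. degree ([:w, 1:] ^ s))"
      unfolding q_def using degree_prod_sum_le[of "V - {v}" "\<lambda>w. [:w, 1:] ^ s"] finV by (simp add: o_def)
    also have "\<dots> = card (V - {v}) * s" by (simp add: degree_linear_power)
    also have "\<dots> \<le> 5 * s" using cardV[OF that] by (intro mult_right_mono) auto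
    finally show ?thesis .
  qed
  have deg_f: "degree f \<le> 5 * s"
    unfolding f_def z sum3_def by (auto intro!: degree_diff_le degree_add_le deg_q simp: V_eq)
  obtain b where b: "b \<in> V" "b \<in> set3 z'" "b \<notin> set3 z" using nondeg by (auto simp: V_def)
  \<comment> \<open>The value of \<open>q b\<close> at \<open>- b\<close>. Every other
    \<open>q v\<close> contains the factor with root \<open>- b\<close> and vanishes there.\<close>
  define K where "K = (\<Prod>w\<in>V - {b}. (w - b) ^ s)"
  have q_b: "poly (q v) (- b) = (if v = b then K else 0)" if "v \<in> V" for v
    using that b finV s by (auto simp: q_def K_def poly_prod poly_power intro!: prod_zero)
  have K: "\<not> int p dvd K"
  proof
    assume "int p dvd K"
    then obtain w where "w \<in> V - {b}" "int p dvd (w - b) ^ s"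
      unfolding K_def using pi finV by (auto simp: prime_dvd_prod_iff)
    with V[of w b] b pi show False by (auto dest!: prime_int_dvd_power[OF p(1)] simp: cong_iff_dvd_diff)
  qed
  have "\<not> int p dvd poly f (- b)"
  proof -
    have "poly f (- b) = - (sum3 (\<lambda>v. if v = b then 1 else 0) z' * K)"
      using b q_b unfolding f_def z sum3_def V_eq set3_def by (auto simp: algebra_simps)
    \<comment> \<open>This is the multiplicity of \<open>b\<close> among the coordinates of
      \<open>z'\<close>: at least 1, at most 3, hence nonzero modulo \<open>p > 3\<close>.\<close>
    moreover have "\<not> int p dvd sum3 (\<lambda>v. if v = b then 1 else 0) z'"
    proof
      assume "int p dvd sum3 (\<lambda>v. if v = b then 1 else 0) z'"
      moreover have "sum3 (\<lambda>v. if v = b then 1 else (0::int)) z' \<in> {1..3}"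
        using b by (auto simp: z sum3_def set3_def)
      ultimately show False using zdvd_imp_le[of "int p"] p(2) by fastforce
    qed
    ultimately show ?thesis using K pi by (simp add: prime_dvd_mult_iff)
  qed
  moreover have "\<And>a. a \<in> A \<Longrightarrow> int p dvd poly f ((\<lambda>(u, x). x * modular_inverse (int p) u) a)"
  proof safe
    fix u x assume a: "(u, x) \<in> A"
    define \<beta> where "\<beta> = x * modular_inverse (int p) u"
    \<comment> \<open>\<open>W\<close> clears the denominators at all points of \<open>V\<close>.
      The factor \<open>c\<close> supplies one \<open>u ^ s\<close> for each of the
      \<open>card V - 1\<close> factors of \<open>q v\<close>, turning \<open>\<beta> + w\<close>
      into \<open>x + u * w\<close>.\<close>
    define W where "W = (\<Prod>w\<in>V. (x + u * w) ^ s)"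
    define c where "c = u ^ (s * (card V - 1))"
    have \<beta>: "[\<beta> * u = x] (mod int p)"
    proof -
      have "[x * (u * modular_inverse (int p) u) = x * 1] (mod int p)"
        using u[OF a] p by (intro cong_mult cong_refl cong_modular_inverse1) (simp add: coprime_prime_int_iff)
      then show ?thesis by (simp add: \<beta>_def mult_ac)
    qed
    have main: "[poly (q v) \<beta> * c = W * inv_pow p s (x + u * v)] (mod int p)" if v: "v \<in> V" for v
    proof -
      have "poly (q v) \<beta> * c = (\<Prod>w\<in>V - {v}. (\<beta> * u + u * w) ^ s)"
      proof -
        have "c = (\<Prod>w\<in>V - {v}. u ^ s)" using v finV by (simp add: c_def power_mult)
        moreover have "poly (q v) \<beta> = (\<Prod>w\<in>V - {v}. (w + \<beta>) ^ s)"
          by (simp add: q_def poly_prod poly_power)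
        ultimately show ?thesis
          by (simp only: prod.distrib[symmetric] power_mult_distrib[symmetric])
            (simp add: algebra_simps)
      qed
      also have "[\<dots> = (\<Prod>w\<in>V - {v}. (x + u * w) ^ s) * 1] (mod int p)"
        unfolding mult_1_right by (intro cong_prod cong_pow cong_add \<beta> cong_refl)
      also have "[(\<Prod>w\<in>V - {v}. (x + u * w) ^ s) * 1 =
          (\<Prod>w\<in>V - {v}. (x + u * w) ^ s) * ((x + u * v) ^ s * inv_pow p s (x + u * v))] (mod int p)"
        by (intro cong_mult cong_refl cong_sym[OF cong_inv_pow[OF p(1) cop[OF a v]]])
      also have "(\<Prod>w\<in>V - {v}. (x + u * w) ^ s) * ((x + u * v) ^ s * inv_pow p s (x + u * v)) =
          W * inv_pow p s (x + u * v)"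
        using prod.remove[OF finV v, of "\<lambda>w. (x + u * w) ^ s"] by (simp add: W_def mult_ac)
      finally show ?thesis .
    qed
    have "poly f \<beta> * c = sum3 (\<lambda>v. poly (q v) \<beta> * c) z - sum3 (\<lambda>v. poly (q v) \<beta> * c) z'"
      by (simp add: f_def sum3_def z algebra_simps)
    also have "[\<dots> = sum3 (\<lambda>v. W * inv_pow p s (x + u * v)) z - sum3 (\<lambda>v. W * inv_pow p s (x + u * v)) z'] (mod int p)"
      unfolding sum3_def z by (auto intro!: cong_diff cong_add main simp: V_eq)
    also have "sum3 (\<lambda>v. W * inv_pow p s (x + u * v)) z - sum3 (\<lambda>v. W * inv_pow p s (x + u * v)) z' =
       W * (sum3 (\<lambda>v. inv_pow p s (x + u * v)) z - sum3 (\<lambda>v. inv_pow p s (x + u * v)) z')"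
      by (simp add: sum3_def z algebra_simps)
    also have "[\<dots> = 0] (mod int p)"
      using sol[OF a] by (simp add: cong_0_iff cong_iff_dvd_diff)
    finally have "int p dvd poly f \<beta> * c" by (simp add: cong_0_iff)
    moreover have "\<not> int p dvd c" using u[OF a] pi by (auto simp: c_def dest: prime_int_dvd_power[OF p(1)])
    ultimately show "int p dvd poly f (x * modular_inverse (int p) u)"
      using pi by (simp add: prime_dvd_mult_iff \<beta>_def)
  qed
  moreover have "a = a'" if aa: "a \<in> A" "a' \<in> A"
    "[(\<lambda>(u, x). x * modular_inverse (int p) u) a = (\<lambda>(u, x). x * modular_inverse (int p) u) a'] (mod int p)" for a a'
  proof -
    obtain u x u' x' where [simp]: "a = (u, x)" "a' = (u', x')" by (metis surj_pair)
    have i: "[v * modular_inverse (int p) v = 1] (mod int p)" if "\<not> int p dvd v" for v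
      using that p by (intro cong_modular_inverse1) (simp add: coprime_prime_int_iff)
    have "[x * u' * 1 = x * u' * (u * modular_inverse (int p) u)] (mod int p)"
      using aa by (intro cong_mult cong_refl cong_sym[OF i] u) auto
    also have "x * u' * (u * modular_inverse (int p) u) = x * modular_inverse (int p) u * (u * u')"
      by (simp add: mult_ac)
    also have "[\<dots> = x' * modular_inverse (int p) u' * (u * u')] (mod int p)"
      using aa by (intro cong_scalar_right) simp
    also have "x' * modular_inverse (int p) u' * (u * u') = x' * u * (u' * modular_inverse (int p) u')"
      by (simp add: mult_ac)
    also have "[\<dots> = x' * u * 1] (mod int p)"
      using aa by (intro cong_mult cong_refl i u) auto
    finally show ?thesis using inj[of u x u' x'] aa by simp
  qed
  ultimately have "card A \<le> degree f"
    using card_le_degree_mod_prime[OF pi _ A, of f "- b"] by blast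
  with deg_f show ?thesis by linarith
qed

lemma sum_card_swap:
  assumes "finite A" "finite B"
  shows "(\<Sum>a\<in>A. card {b \<in> B. R a b}) = (\<Sum>b\<in>B. card {a \<in> A. R a b})"
proof -
  have card_eq: "card {c \<in> C. Q c} = (\<Sum>c\<in>C. if Q c then 1 else 0)" if "finite C" for C :: "'c set" and Q
    using that by (simp add: sum.If_cases Int_def)
  show ?thesis
    unfolding card_eq[OF assms(1)] card_eq[OF assms(2)] by (rule sum.swap)
qed

text \<open>Given the first triple, each coordinate of the second is one of at most three values,
  which leaves at most 27 choices.\<close>

lemma card_degenerate_le:
  assumes "finite I"
  shows "card {w \<in> (I \<times> I \<times> I) \<times> (I \<times> I \<times> I). set3 (snd w) \<subseteq> set3 (fst w)} \<le> 27 * card I ^ 3"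
proof -
  have "{w \<in> (I \<times> I \<times> I) \<times> (I \<times> I \<times> I). set3 (snd w) \<subseteq> set3 (fst w)} \<subseteq>
      (SIGMA z:I \<times> I \<times> I. set3 z \<times> set3 z \<times> set3 z)"
    by (auto simp: set3_def)
  then have "card {w \<in> (I \<times> I \<times> I) \<times> (I \<times> I \<times> I). set3 (snd w) \<subseteq> set3 (fst w)} \<le>
      card (SIGMA z:I \<times> I \<times> I. set3 z \<times> set3 z \<times> set3 z)"
    using assms by (intro card_mono finite_SigmaI) (auto simp: set3_def)
  also have "\<dots> = (\<Sum>z\<in>I \<times> I \<times> I. card (set3 z) * (card (set3 z) * card (set3 z)))"
    using assms by (subst card_SigmaI) (auto simp: set3_def card_cartesian_product)
  also have "\<dots> \<le> (\<Sum>z\<in>I \<times> I \<times> I. 3 * (3 * 3))"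
  proof (intro sum_mono mult_mono)
    fix z :: "'a \<times> 'a \<times> 'a"
    obtain a b c where "z = (a, b, c)" by (metis prod_cases3)
    then have "card (set3 z) = card (set [a, b, c])" by (simp add: set3_def)
    also have "\<dots> \<le> 3" by (rule order_trans[OF card_length]) simp
    finally show "card (set3 z) \<le> 3" "card (set3 z) \<le> 3" "card (set3 z) \<le> 3" by auto
  qed auto
  also have "\<dots> = 27 * card I ^ 3" by (simp add: card_cartesian_product power3_eq_cube)
  finally show ?thesis .
qed

lemma finite_int_primes [simp]: "finite {q::int. prime q \<and> q \<le> n}"
proof (rule finite_subset)
  show "{q::int. prime q \<and> q \<le> n} \<subseteq> {0..n}"
    by (intro subsetI) (simp add: prime_ge_0_int)
qed (rule finite_atLeastAtMost_int)

lemma card_int_primes: "card {q::int. prime q \<and> q \<le> int n} = prime_count n"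
proof -
  have "{q::int. prime q \<and> q \<le> int n} = int ` {q. prime q \<and> q \<le> n}"
  proof safe
    fix q :: int assume q: "prime q" "q \<le> int n"
    obtain m where "q = int m" using zero_le_imp_eq_int[OF prime_ge_0_int[OF q(1)]] by blast
    then show "q \<in> int ` {q. prime q \<and> q \<le> n}" using q by simp
  qed auto
  then show ?thesis by (simp add: prime_count_def card_image)
qed

text \<open>The sum over \<open>X\<close> is averaged over \<open>k * r\<close> shifts, with
  \<open>k = prime_count r\<close>. Hoelder's inequality reduces its energy to those of the sets
  \<open>T (u, x)\<close>, which are bounded by fixing six shifts and counting
  \<open>(u, x)\<close>. One factor \<open>k\<close> stays on the left, as \<open>k ^ 6\<close>
  meets only the \<open>k ^ 5\<close> from \<open>card P ^ 5\<close>.\<close>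

lemma energy_prime_powers_le:
  fixes r :: nat
  defines "X \<equiv> {q::int. prime q \<and> q \<le> int (r ^ 2) \<and> int r < q}"
  assumes p: "prime p" and s: "s > 0" and r: "r \<ge> 2" "2 * r ^ 3 < p"
  shows "energy p (sum3 (inv_pow p s)) (X \<times> X \<times> X) * prime_count r \<le> 243 * (81 + 5 * s) * r ^ 10"
proof -
  define U where "U = {q::int. prime q \<and> q \<le> int r}"
  define k where "k = prime_count r"
  define I where "I = {1..int r}"
  \<comment> \<open>A prime in \<open>X\<close> exceeds \<open>r\<close>, so no \<open>u \<in> U\<close> divides \<open>x = y - u t\<close> for \<open>y \<in> X\<close>. With this
    condition \<open>x / u\<close> determines \<open>(u, x)\<close>.\<close>
  define P where "P = {(u, x) \<in> U \<times> {- int (r ^ 2)..int (r ^ 2)}. \<not> u dvd x}"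
  define T where "T = (\<lambda>(u, x). {t \<in> I. x + u * t \<in> X})"
  define \<psi> where "\<psi> = inv_pow p s"
  define F where "F = (\<lambda>b. \<Sum>y\<in>X. add_char p (b * \<psi> y))"
  define G where "G = (\<lambda>w b. \<Sum>t\<in>T w. add_char p (b * \<psi> (snd w + fst w * t)))"
  have finX: "finite X"
    by (rule finite_subset[of _ "{q. prime q \<and> q \<le> int (r ^ 2)}"]) (auto simp: X_def)
  have finU: "finite U" and finI: "finite I"
    by (simp_all add: U_def I_def)
  have finT: "finite (T w)" for w
    by (rule finite_subset[OF _ finI]) (auto simp: T_def case_prod_unfold)
  have finP: "finite P"
    by (rule finite_subset[of _ "U \<times> {- int (r ^ 2)..int (r ^ 2)}"]) (auto simp: P_def finU)
  have cardU: "card U = k" by (simp add: U_def k_def card_int_primes)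
  have k: "k > 0"
  proof -
    have "{2} \<subseteq> {q. prime q \<and> q \<le> r}" using r by auto
    then have "card {2::nat} \<le> k" unfolding k_def prime_count_def by (intro card_mono) auto
    then show ?thesis by simp
  qed
  have k_le: "k \<le> r"
  proof -
    have "card U \<le> card I" unfolding U_def I_def by (intro card_mono) (auto dest: prime_gt_0_int)
    then show ?thesis by (simp add: cardU I_def)
  qed
  have cardP: "card P \<le> 3 * k * r ^ 2"
  proof -
    have "card P \<le> card (U \<times> {- int (r ^ 2)..int (r ^ 2)})"
      by (intro card_mono) (auto simp: P_def finU)
    also have "\<dots> = k * (2 * r ^ 2 + 1)" by (simp add: card_cartesian_product cardU nat_add_distrib nat_mult_distrib nat_power_eq)
    also have "\<dots> \<le> k * (3 * r ^ 2)" using r by (intro mult_left_mono) auto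
    finally show ?thesis by simp
  qed
  have pgt: "int p > 2 * int r ^ 3" "p > 3"
  proof -
    have "int (2 * r ^ 3) < int p" using r(2) by (simp only: of_nat_less_iff)
    then show "int p > 2 * int r ^ 3" by simp
    have "(2::nat) ^ 3 \<le> r ^ 3" using r(1) by (intro power_mono) auto
    then show "p > 3" using r(2) by simp
  qed
  have r23: "int r ^ 2 \<le> int r ^ 3" "int r \<le> int r ^ 3"
    using r(1) power_increasing[of 2 3 "int r"] power_increasing[of 1 3 "int r"] by auto
  have U_bounds: "1 < u" "u \<le> int r" if "u \<in> U" for u using that prime_gt_1_int by (auto simp: U_def)
  have X_bounds: "int r < y" "y \<le> int r ^ 2" if "y \<in> X" for y using that by (auto simp: X_def)
  have not_dvd: "\<not> int p dvd v" if "0 < v" "v \<le> int r ^ 3" for v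
    using that pgt zdvd_imp_le[of "int p" v] by auto
  \<comment> \<open>Each \<open>y\<close> is written as \<open>x + u * t\<close> once for each of
    the \<open>k * r\<close> pairs \<open>(u, t)\<close>. Collecting terms with the same
    \<open>(u, x)\<close> gives the sums \<open>G\<close>.\<close>
  have shift: "of_nat (k * r) * F b = (\<Sum>w\<in>P. G w b)" for b
  proof -
    have "of_nat (k * r) * F b = (\<Sum>u\<in>U. \<Sum>t\<in>I. \<Sum>y\<in>X. add_char p (b * \<psi> y))"
      by (simp add: F_def cardU I_def)
    also have "\<dots> = (\<Sum>(u, t, y)\<in>U \<times> I \<times> X. add_char p (b * \<psi> y))"
      by (simp only: sum.cartesian_product case_prod_unfold)
    also have "\<dots> = (\<Sum>((u, x), t)\<in>Sigma P T. add_char p (b * \<psi> (x + u * t)))"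
    proof (rule sum.reindex_bij_witness[of _ "\<lambda>((u, x), t). (u, t, x + u * t)" "\<lambda>(u, t, y). ((u, y - u * t), t)"])
      fix a assume "a \<in> U \<times> I \<times> X"
      then obtain u t y where a: "a = (u, t, y)" "u \<in> U" "t \<in> I" "y \<in> X" by auto
      have "0 < u * t" "u * t \<le> int r * int r"
        using U_bounds[OF a(2)] a(3) by (auto simp: I_def intro!: mult_mono mult_pos_pos)
      moreover have "\<not> u dvd y - u * t"
      proof
        assume "u dvd y - u * t"
        then have "u dvd (y - u * t) + u * t" by (intro dvd_add) auto
        then have "u dvd y" by simp
        with a have "u = y" by (intro primes_dvd_imp_eq) (auto simp: U_def X_def)
        then show False using U_bounds[OF a(2)] X_bounds[OF a(4)] by simp
      qed
      ultimately show "(\<lambda>(u, t, y). ((u, y - u * t), t)) a \<in> Sigma P T"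
        using a X_bounds[OF a(4)] by (auto simp: P_def T_def power2_eq_square)
    qed (auto simp: P_def T_def)
    also have "\<dots> = (\<Sum>w\<in>P. G w b)"
      using finP finT by (simp add: G_def sum.Sigma case_prod_unfold)
    finally show ?thesis .
  qed
  have pointwise: "real (k * r) ^ 6 * norm (F b) ^ 6 \<le> real (card P) ^ 5 * (\<Sum>w\<in>P. norm (G w b) ^ 6)" for b
  proof -
    have "real (k * r) * norm (F b) = norm (\<Sum>w\<in>P. G w b)"
      unfolding shift[symmetric] norm_mult norm_of_nat ..
    then have "real (k * r) ^ 6 * norm (F b) ^ 6 = norm (\<Sum>w\<in>P. G w b) ^ 6"
      by (simp only: power_mult_distrib[symmetric])
    also have "\<dots> \<le> (\<Sum>w\<in>P. norm (G w b)) ^ 6" by (intro power_mono norm_sum) auto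
    also have "\<dots> \<le> real (card P) ^ 5 * (\<Sum>w\<in>P. norm (G w b) ^ 6)"
      using power_sum_le_card_power[of 4 "\<lambda>w. norm (G w b)" P] by simp
    finally show ?thesis .
  qed
  define E where "E = energy p (sum3 \<psi>) (X \<times> X \<times> X)"
  define E' where "E' = (\<Sum>(u, x)\<in>P. energy p (sum3 (\<lambda>t. \<psi> (x + u * t))) (T (u, x) \<times> T (u, x) \<times> T (u, x)))"
  have p0: "p > 0" using p prime_gt_0_nat by blast
  have "real p * (real (k * r) ^ 6 * real E) = (\<Sum>b\<in>{0..<int p}. real (k * r) ^ 6 * norm (F b) ^ 6)"
    unfolding F_def sum_distrib_left[symmetric] sum_norm_power6_exp_sum[OF p0 finX] by (simp add: E_def)
  also have "\<dots> \<le> (\<Sum>b\<in>{0..<int p}. real (card P) ^ 5 * (\<Sum>w\<in>P. norm (G w b) ^ 6))"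
    by (intro sum_mono pointwise)
  also have "\<dots> = real (card P) ^ 5 * (\<Sum>w\<in>P. \<Sum>b\<in>{0..<int p}. norm (G w b) ^ 6)"
    by (subst sum.swap) (simp add: sum_distrib_left)
  also have "\<dots> = real p * (real (card P) ^ 5 * real E')"
    unfolding G_def sum_norm_power6_exp_sum[OF p0 finT] E'_def
    by (simp add: case_prod_unfold sum_distrib_left mult_ac)
  finally have "real (k * r) ^ 6 * real E \<le> real (card P) ^ 5 * real E'" using p0 by simp
  then have "real ((k * r) ^ 6 * E) \<le> real (card P ^ 5 * E')" by simp
  then have EE': "(k * r) ^ 6 * E \<le> card P ^ 5 * E'" by (simp only: of_nat_le_iff)
  define J where "J = (I \<times> I \<times> I) \<times> (I \<times> I \<times> I)"
  \<comment> \<open>Here \<open>w\<close> is a pair \<open>(u, x)\<close> and \<open>z\<close> a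
    pair of triples of shifts. The order of counting is reversed: \<open>z\<close> is fixed and
    \<open>w\<close> varies.\<close>
  define R where "R = (\<lambda>w z. set3 (fst z) \<union> set3 (snd z) \<subseteq> T w \<and>
    [sum3 (\<lambda>t. \<psi> (snd w + fst w * t)) (fst z) = sum3 (\<lambda>t. \<psi> (snd w + fst w * t)) (snd z)] (mod int p))"
  have finJ: "finite J" by (simp add: J_def finI)
  have cardJ: "card J = r ^ 6" by (simp add: J_def card_cartesian_product I_def numeral_eq_Suc mult_ac)
  have "E' \<le> (\<Sum>w\<in>P. card {z \<in> J. R w z})"
    unfolding E'_def energy_def
  proof (intro sum_mono, clarify)
    fix u x
    show "card {(z, z'). (z, z') \<in> (T (u, x) \<times> T (u, x) \<times> T (u, x)) \<times> (T (u, x) \<times> T (u, x) \<times> T (u, x)) \<and>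
        [sum3 (\<lambda>t. \<psi> (x + u * t)) z = sum3 (\<lambda>t. \<psi> (x + u * t)) z'] (mod int p)} \<le> card {z \<in> J. R (u, x) z}"
      using finJ by (intro card_mono) (auto simp: J_def R_def set3_def T_def)
  qed
  also have "\<dots> = (\<Sum>z\<in>J. card {w \<in> P. R w z})" by (rule sum_card_swap[OF finP finJ])
  \<comment> \<open>A degenerate \<open>z\<close> is charged all of \<open>P\<close>; any other has
    at most \<open>5 * s\<close> solutions by the polynomial argument.\<close>
  also have "\<dots> \<le> (\<Sum>z\<in>J. 5 * s + (if set3 (snd z) \<subseteq> set3 (fst z) then card P else 0))"
  proof (intro sum_mono)
    fix z assume z: "z \<in> J"
    show "card {w \<in> P. R w z} \<le> 5 * s + (if set3 (snd z) \<subseteq> set3 (fst z) then card P else 0)"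
    proof (cases "set3 (snd z) \<subseteq> set3 (fst z)")
      case True
      have "card {w \<in> P. R w z} \<le> card P" using finP by (intro card_mono) auto
      with True show ?thesis by simp
    next
      case False
      have VI: "set3 (fst z) \<union> set3 (snd z) \<subseteq> I" using z by (auto simp: J_def set3_def)
      have "card {w \<in> P. R w z} \<le> 5 * s"
      proof (rule card_shifted_solutions_le[OF p pgt(2) s _ False])
        show "v = w" if "v \<in> set3 (fst z) \<union> set3 (snd z)" "w \<in> set3 (fst z) \<union> set3 (snd z)" "[v = w] (mod int p)" for v w
        proof (rule cong_imp_eq_of_abs_less[OF that(3)])
          have "v \<in> I" "w \<in> I" using that VI by auto
          then have "1 \<le> v" "v \<le> int r" "1 \<le> w" "w \<le> int r" by (auto simp: I_def)
          then show "\<bar>v - w\<bar> < int p" using pgt(1) r23(2) by linarith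
        qed
        show "\<not> int p dvd u" if "(u, x) \<in> {w \<in> P. R w z}" for u x
        proof (rule not_dvd)
          have "u \<in> U" using that by (auto simp: P_def)
          from U_bounds[OF this] show "0 < u" "u \<le> int r ^ 3" using r23 by linarith+
        qed
        show "\<not> int p dvd x + u * v" if "(u, x) \<in> {w \<in> P. R w z}" "v \<in> set3 (fst z) \<union> set3 (snd z)" for u x v
        proof (rule not_dvd)
          have "x + u * v \<in> X" using that by (auto simp: R_def T_def)
          from X_bounds[OF this] show "0 < x + u * v" "x + u * v \<le> int r ^ 3" using r23 by linarith+
        qed
        show "(u, x) = (u', x')" if a: "(u, x) \<in> {w \<in> P. R w z}" "(u', x') \<in> {w \<in> P. R w z}"
          "[x * u' = x' * u] (mod int p)" for u x u' x'
        proof -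
          have u: "u \<in> U" "u' \<in> U" "\<not> u dvd x" "\<not> u' dvd x'" and x: "\<bar>x\<bar> \<le> int r ^ 2" "\<bar>x'\<bar> \<le> int r ^ 2"
            using a by (auto simp: P_def)
          \<comment> \<open>Both products are at most \<open>r ^ 3\<close> in absolute value and
            \<open>2 * r ^ 3 < p\<close>, so the congruence is an equality. As the prime
            \<open>u\<close> does not divide \<open>x\<close>, it divides \<open>u'\<close>.\<close>
          have "\<bar>x * u'\<bar> \<le> int r ^ 2 * int r" "\<bar>x' * u\<bar> \<le> int r ^ 2 * int r"
            unfolding abs_mult using x U_bounds[OF u(1)] U_bounds[OF u(2)] by (auto intro!: mult_mono)
          then have "\<bar>x * u' - x' * u\<bar> < int p" using pgt(1) by (simp add: power3_eq_cube power2_eq_square)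
          then have eq: "x * u' = x' * u" by (rule cong_imp_eq_of_abs_less[OF a(3)])
          then have "u dvd x * u'" by simp
          then have "u dvd u'" using u by (auto simp: U_def prime_dvd_mult_iff)
          then have "u = u'" using u by (auto simp: U_def intro: primes_dvd_imp_eq)
          then show ?thesis using eq U_bounds[OF u(1)] by simp
        qed
      qed (use finP in \<open>auto simp: R_def \<psi>_def\<close>)
      with False show ?thesis by simp
    qed
  qed
  also have "\<dots> = 5 * s * r ^ 6 + card {z \<in> J. set3 (snd z) \<subseteq> set3 (fst z)} * card P"
    using finJ by (simp add: sum.distrib cardJ sum.If_cases Int_def mult_ac)
  also have "card {z \<in> J. set3 (snd z) \<subseteq> set3 (fst z)} \<le> 27 * r ^ 3"
    using card_degenerate_le[OF finI] by (simp add: J_def I_def)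
  finally have "E' \<le> 5 * s * r ^ 6 + 27 * r ^ 3 * card P" by simp
  \<comment> \<open>With \<open>card P \<le> 3 * k * r ^ 2\<close> and \<open>k \<le> r\<close>, the
    degenerate part is at most \<open>81 * r ^ 6\<close>, of the same order as the rest.\<close>
  also have "\<dots> \<le> 5 * s * r ^ 6 + 27 * r ^ 3 * (3 * r * r ^ 2)"
    using cardP k_le by (intro add_left_mono mult_left_mono order_trans[OF cardP] mult_right_mono) auto
  also have "\<dots> = (81 + 5 * s) * r ^ 6"
  proof -
    have "r ^ 6 = r ^ 3 * (r * r ^ 2)" by (simp flip: power_add power_Suc)
    then show ?thesis by (simp add: algebra_simps)
  qed
  finally have "(k * r) ^ 6 * E \<le> (3 * k * r ^ 2) ^ 5 * ((81 + 5 * s) * r ^ 6)"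
    using EE' cardP by (meson order_trans mult_mono power_mono zero_le)
  moreover have "(k * r) ^ 6 = (k ^ 5 * r ^ 6) * k"
    using power_Suc2[of k 5] by (simp add: power_mult_distrib mult_ac)
  moreover have "(3 * k * r ^ 2) ^ 5 = 243 * k ^ 5 * r ^ 10"
    by (simp add: power_mult_distrib flip: power_mult)
  ultimately have "(k ^ 5 * r ^ 6) * k * E \<le> 243 * k ^ 5 * r ^ 10 * ((81 + 5 * s) * r ^ 6)"
    by (simp only:)
  then have "(k ^ 5 * r ^ 6) * (E * k) \<le> (k ^ 5 * r ^ 6) * (243 * (81 + 5 * s) * r ^ 10)"
    by (simp only: mult_ac)
  moreover have "0 < k ^ 5 * r ^ 6" using k r(1) by simp
  ultimately have "E * k \<le> 243 * (81 + 5 * s) * r ^ 10" by (simp only: mult_le_cancel1)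
  then show ?thesis unfolding E_def \<psi>_def k_def .
qed

section \<open>Ternary sums of products\<close>

text \<open>Hoelder's inequality over \<open>m\<close>, then completion: multiplication by
  \<open>b\<close> is injective modulo \<open>p\<close>, so the sixth powers that occur are part of
  the full sixth moment.\<close>

lemma exp_sum_product_le:
  assumes p: "prime p" and M: "M \<subseteq> {1..<int p}" and X: "finite X" and b: "\<not> int p dvd b"
  shows "norm (\<Sum>w\<in>M \<times> X. add_char p (b * (fst w * \<psi> (snd w)))) ^ 6 \<le>
    real (card M ^ 5 * (p * energy p (sum3 \<psi>) (X \<times> X \<times> X)))"
proof -
  have p0: "p > 0" using p prime_gt_0_nat by blast
  define F where "F = (\<lambda>c. \<Sum>x\<in>X. add_char p (c * \<psi> x))"
  define h where "h = (\<lambda>m. (b * m) mod int p)"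
  have F_cong: "F (b * m) = F (h m)" for m
    unfolding F_def h_def
    by (rule sum.cong[OF refl], rule add_char_cong[OF p0], rule cong_scalar_right) (simp add: Cong.cong_def)
  have inj: "inj_on h M"
  proof
    fix m m' assume m: "m \<in> M" "m' \<in> M" "h m = h m'"
    then have "[m * b = m' * b] (mod int p)" by (simp add: h_def Cong.cong_def mult.commute[of _ b])
    then have "[m = m'] (mod int p)" by (rule cong_cancel_prime[OF p b])
    moreover have "m \<in> {1..<int p}" "m' \<in> {1..<int p}" using m M by auto
    then have "\<bar>m - m'\<bar> < int p" by auto
    ultimately show "m = m'" by (rule cong_imp_eq_of_abs_less)
  qed
  have "(\<Sum>w\<in>M \<times> X. add_char p (b * (fst w * \<psi> (snd w)))) = (\<Sum>m\<in>M. F (h m))"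
    unfolding F_cong[symmetric] by (simp add: F_def sum.cartesian_product case_prod_unfold mult.assoc)
  then have "norm (\<Sum>w\<in>M \<times> X. add_char p (b * (fst w * \<psi> (snd w)))) ^ 6 \<le> (\<Sum>m\<in>M. norm (F (h m))) ^ 6"
    by (simp add: norm_sum power_mono)
  also have "\<dots> \<le> real (card M) ^ 5 * (\<Sum>m\<in>M. norm (F (h m)) ^ 6)"
    using power_sum_le_card_power[of 4 "\<lambda>m. norm (F (h m))" M] by simp
  also have "(\<Sum>m\<in>M. norm (F (h m)) ^ 6) = (\<Sum>c\<in>h ` M. norm (F c) ^ 6)"
    using inj by (simp add: sum.reindex)
  also have "\<dots> \<le> (\<Sum>c\<in>{0..<int p}. norm (F c) ^ 6)"
    using p0 by (intro sum_mono2) (auto simp: h_def)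
  also have "\<dots> = real (p * energy p (sum3 \<psi>) (X \<times> X \<times> X))"
    unfolding F_def by (rule sum_norm_power6_exp_sum[OF p0 X])
  finally show ?thesis by (simp add: mult_left_mono)
qed

text \<open>Let \<open>J\<close> and \<open>E\<close> be the two energies in \<open>less\<close>. At
  \<open>b\<close> nonzero the sixth power of the sum is at most \<open>card M ^ 5 * p * J\<close>,
  and the second moment is \<open>p * E\<close>. The hypothesis \<open>less\<close> is the circle
  method condition raised to the sixth power, which keeps it free of roots.\<close>

lemma ternary_representation:
  assumes p: "prime p" and M: "M \<subseteq> {1..<int p}" and X: "finite X"
    and less: "card M ^ 5 * p ^ 7 * energy p (sum3 \<psi>) (X \<times> X \<times> X) * energy p (\<lambda>(m, x). m * \<psi> x) (M \<times> X) ^ 6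
      < (card M * card X) ^ 18"
  shows "\<exists>m1\<in>M. \<exists>m2\<in>M. \<exists>m3\<in>M. \<exists>x1\<in>X. \<exists>x2\<in>X. \<exists>x3\<in>X.
    [m1 * \<psi> x1 + m2 * \<psi> x2 + m3 * \<psi> x3 = l] (mod int p)"
proof (rule ccontr)
  assume none: "\<not> ?thesis"
  have p0: "p > 0" using p prime_gt_0_nat by blast
  define g where "g = (\<lambda>w. fst w * \<psi> (snd w))"
  define Z where "Z = M \<times> X"
  define S where "S = (\<lambda>b. \<Sum>w\<in>Z. add_char p (b * g w))"
  define J where "J = energy p (sum3 \<psi>) (X \<times> X \<times> X)"
  define E where "E = energy p g Z"
  define B where "B = root 6 (real (card M ^ 5 * (p * J)))"
  have g_eq: "g = (\<lambda>(m, x). m * \<psi> x)" by (auto simp: g_def)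
  have finZ: "finite Z" using M X finite_subset unfolding Z_def by blast
  have B: "B \<ge> 0" "B ^ 6 = real (card M ^ 5 * (p * J))"
    by (simp_all add: B_def del: of_nat_mult of_nat_power)
  have S_le: "norm (S b) \<le> B" if "b \<in> {0<..<int p}" for b
  proof -
    have "\<not> int p dvd b" using that zdvd_not_zless[of b "int p"] by auto
    then have "norm (S b) ^ 6 \<le> B ^ 6"
      unfolding B(2) J_def S_def Z_def g_def by (rule exp_sum_product_le[OF p M X])
    then show ?thesis using B(1) by (simp add: power_mono_iff)
  qed
  \<comment> \<open>Without a representation of \<open>l\<close> the count by characters is 0, so
    the term at \<open>b = 0\<close> must be cancelled by all others.\<close>
  have "{w \<in> Z \<times> Z \<times> Z. int p dvd sum3 g w - l} = {}"
    using none by (force simp: Z_def sum3_def g_def cong_iff_dvd_diff)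
  then have "(\<Sum>b\<in>{0..<int p}. \<Sum>w\<in>Z \<times> Z \<times> Z. add_char p (b * (sum3 g w - l))) = 0"
    using finZ by (subst sum_add_char_eq_card[OF p0]) auto
  moreover have "(\<Sum>w\<in>Z \<times> Z \<times> Z. add_char p (b * (sum3 g w - l))) = S b ^ 3 * add_char p (- (b * l))" for b
    unfolding S_def exp_sum_cube sum_distrib_right add_char_add[symmetric]
    by (simp add: right_diff_distrib)
  ultimately have "0 = (\<Sum>b\<in>{0..<int p}. S b ^ 3 * add_char p (- (b * l)))" by simp
  also have "{0..<int p} = insert 0 {0<..<int p}" using p0 by auto
  also have "(\<Sum>b\<in>insert 0 {0<..<int p}. S b ^ 3 * add_char p (- (b * l))) =
      S 0 ^ 3 + (\<Sum>b\<in>{0<..<int p}. S b ^ 3 * add_char p (- (b * l)))" by simp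
  finally have "S 0 ^ 3 = - (\<Sum>b\<in>{0<..<int p}. S b ^ 3 * add_char p (- (b * l)))"
    by (simp add: eq_neg_iff_add_eq_0)
  then have "norm (S 0 ^ 3) \<le> (\<Sum>b\<in>{0<..<int p}. norm (S b ^ 3 * add_char p (- (b * l))))"
    by (simp only: norm_minus_cancel norm_sum)
  \<comment> \<open>One of the three factors is bounded by the maximum \<open>B\<close>; the other
    two form the second moment.\<close>
  also have "\<dots> \<le> (\<Sum>b\<in>{0<..<int p}. B * norm (S b) ^ 2)"
  proof (intro sum_mono)
    fix b assume "b \<in> {0<..<int p}"
    then have "norm (S b) * norm (S b) ^ 2 \<le> B * norm (S b) ^ 2"
      by (intro mult_right_mono S_le) auto
    then show "norm (S b ^ 3 * add_char p (- (b * l))) \<le> B * norm (S b) ^ 2"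
      by (simp add: norm_mult norm_power flip: power_Suc)
  qed
  also have "\<dots> \<le> (\<Sum>b\<in>{0..<int p}. B * norm (S b) ^ 2)"
    using B(1) by (intro sum_mono2) auto
  also have "\<dots> = B * real (p * E)"
    unfolding sum_distrib_left[symmetric] S_def sum_norm_square_exp_sum[OF p0 finZ] E_def ..
  finally have "norm (S 0 ^ 3) ^ 6 \<le> (B * real (p * E)) ^ 6"
    by (intro power_mono) auto
  also have "\<dots> = real (card M ^ 5 * (p * J)) * real (p * E) ^ 6"
    unfolding power_mult_distrib B(2) ..
  also have "norm (S 0 ^ 3) ^ 6 = real ((card M * card X) ^ 18)"
    by (simp add: S_def Z_def card_cartesian_product norm_mult norm_power flip: power_mult)
  finally have "real ((card M * card X) ^ 18) \<le> real (card M ^ 5 * (p * J) * (p * E) ^ 6)"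
    by simp
  then have "(card M * card X) ^ 18 \<le> card M ^ 5 * (p * J) * (p * E) ^ 6"
    by (simp only: of_nat_le_iff)
  also have "\<dots> = card M ^ 5 * p ^ 7 * J * E ^ 6"
  proof -
    have "p ^ 7 = p * p ^ 6" by (simp flip: power_Suc)
    then show ?thesis by (simp add: power_mult_distrib mult_ac)
  qed
  finally show False using less unfolding J_def E_def Z_def g_eq by linarith
qed

section \<open>Choice of parameters for large p and comparison of exponents\<close>

text \<open>The bound on \<open>e\<close> gives \<open>7/29 + 2 * e \<le> 57/232 < 1/4\<close>,
  hence \<open>r p ^ 4 < p\<close>. The exponent of \<open>r\<close> exceeds \<open>7/29 + e\<close>
  by \<open>e\<close> to make up for the floor, and the constants depending on \<open>s\<close> are
  absorbed by \<open>p powr e\<close>.\<close>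

lemma eventually_parameters:
  fixes s :: nat and e :: real
  assumes e: "0 < e" "e \<le> 1/464"
  defines "r \<equiv> \<lambda>p::nat. nat \<lfloor>real p powr (7/29 + 2 * e)\<rfloor>"
  shows "eventually (\<lambda>p. r p \<ge> 2 \<and> 2 * r p ^ 3 < p \<and> r p ^ 4 < p \<and>
    real p powr (7/29 + e) \<le> real (r p) \<and>
    real (r p) powr (2 - 3 * e) \<le> real (prime_count (r p ^ 2)) - real (prime_count (r p)) \<and>
    real (r p) powr (1 - e) \<le> real (prime_count (r p)) \<and>
    128 * real (1 + s) ^ 6 * real (243 * (81 + 5 * s)) < real p powr e \<and>
    real p powr (14/29) \<ge> 2) sequentially"
proof -
  have r_top: "filterlim r at_top sequentially"
    unfolding r_def using e by real_asymp
  have r2_top: "filterlim (\<lambda>p. r p ^ 2) at_top sequentially"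
    by (rule filterlim_compose[OF _ r_top]) real_asymp
  have "eventually (\<lambda>p. r p \<ge> 2) sequentially"
    using r_top by (simp add: filterlim_at_top)
  moreover have "eventually (\<lambda>p::nat. 2 * (real p powr (57/232)) ^ 3 < real p) sequentially"
    by real_asymp
  moreover have "eventually (\<lambda>p::nat. (real p powr (57/232)) ^ 4 < real p) sequentially"
    by real_asymp
  moreover have "eventually (\<lambda>p::nat. real p powr (7/29 + e) + 1 \<le> real p powr (7/29 + 2 * e)) sequentially"
    using e by real_asymp
  moreover have "eventually (\<lambda>p. real (prime_count (r p)) \<ge> real (r p) powr (1 - e)) sequentially"
    using eventually_compose_filterlim[OF prime_count_ge_powr[OF e(1)] r_top] .
  moreover have "eventually (\<lambda>p. real (prime_count (r p ^ 2)) \<ge> real (r p ^ 2) powr (1 - e)) sequentially"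
    using eventually_compose_filterlim[OF prime_count_ge_powr[OF e(1)] r2_top] .
  \<comment> \<open>Removing the primes up to \<open>r\<close> from those up to \<open>r ^ 2\<close>
    costs at most \<open>r\<close>, which the additional loss of \<open>e\<close> in the exponent
    absorbs.\<close>
  moreover have "eventually (\<lambda>n::nat. real n powr (2 - 3 * e) \<le> real n powr (2 * (1 - e)) - real n) sequentially"
    using e by real_asymp
  from eventually_compose_filterlim[OF this r_top]
  have "eventually (\<lambda>p. real (r p) powr (2 - 3 * e) \<le> real (r p) powr (2 * (1 - e)) - real (r p)) sequentially" .
  moreover have "eventually (\<lambda>p::nat. c < real p powr e) sequentially" for c
    using e by real_asymp
  from this[of "128 * real (1 + s) ^ 6 * real (243 * (81 + 5 * s))"]
  have "eventually (\<lambda>p::nat. 128 * real (1 + s) ^ 6 * real (243 * (81 + 5 * s)) < real p powr e) sequentially" .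
  moreover have "eventually (\<lambda>p::nat. real p powr (14/29) \<ge> 2) sequentially"
    by real_asymp
  ultimately show ?thesis
    using eventually_gt_at_top[of 1]
  proof eventually_elim
    case (elim p)
    have r_le: "real (r p) \<le> real p powr (7/29 + 2 * e)"
      unfolding r_def by simp
    also have "\<dots> \<le> real p powr (57/232)" using elim e by (intro powr_mono) auto
    finally have r_le': "real (r p) \<le> real p powr (57/232)" .
    have "real (2 * r p ^ 3) \<le> 2 * (real p powr (57/232)) ^ 3"
      using r_le' by (simp add: power_mono)
    then have 1: "2 * r p ^ 3 < p" using elim by linarith
    have "real (r p ^ 4) \<le> (real p powr (57/232)) ^ 4"
      using r_le' by (simp add: power_mono)
    then have 2: "r p ^ 4 < p" using elim by linarith
    have "real p powr (7/29 + 2 * e) - 1 \<le> real (r p)" unfolding r_def by linarith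
    then have 3: "real p powr (7/29 + e) \<le> real (r p)" using elim by linarith
    have "prime_count (r p) \<le> card {1..r p}"
      unfolding prime_count_def by (intro card_mono) (auto dest: prime_gt_0_nat)
    then have "real (prime_count (r p)) \<le> real (r p)" by simp
    moreover have "real (r p ^ 2) powr (1 - e) = real (r p) powr (2 * (1 - e))"
    proof -
      have "real (r p ^ 2) = real (r p) powr 2" using elim by simp
      then show ?thesis by (simp only: powr_powr)
    qed
    ultimately have 4: "real (r p) powr (2 - 3 * e) \<le> real (prime_count (r p ^ 2)) - real (prime_count (r p))"
      using elim by linarith
    show ?case using elim 1 2 3 4 by simp
  qed
qed

text \<open>For \<open>N = p powr (14/29)\<close>, \<open>r = p powr (7/29)\<close>,
  \<open>Y = r ^ 2\<close>, \<open>J = r ^ 9\<close> and \<open>A = N * Y\<close>, both sides equal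
  \<open>p powr (504/29)\<close>; this balance is the source of the exponent \<open>14/29\<close>.
  The surplus \<open>e\<close> in the exponent of \<open>r\<close> outweighs the losses of order
  \<open>e\<close> elsewhere.\<close>

lemma parameter_inequality:
  fixes p e r k N Y J A s :: real
  assumes p: "p > 1" and e: "0 < e" "e \<le> 1/464" and r: "r > 0" "p powr (7/29 + e) \<le> r"
    and k: "r powr (1 - e) \<le> k" and Y: "r powr (2 - 3 * e) \<le> Y"
    and N: "p powr (14/29) / 2 \<le> N" "N \<le> p powr (14/29)"
    and J: "0 \<le> J" "J * k \<le> C * r ^ 10"
    and A: "0 \<le> A" "A \<le> N * Y + s * N ^ 2" and s: "s \<ge> 0"
    and big: "128 * (1 + s) ^ 6 * C < p powr e"
  shows "N ^ 5 * p ^ 7 * J * A ^ 6 < (N * Y) ^ 18"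
proof -
  have powr_r: "p powr ((7/29 + e) * a) \<le> r powr a" if "a \<ge> 0" for a
    using r that powr_mono2[of a "p powr (7/29 + e)" r] by (simp add: powr_powr)
  have k0: "k > 0" using k r by (smt (verit) powr_gt_zero)
  have N0: "N > 0" using N(1) p by (smt (verit) powr_gt_zero half_gt_zero)
  \<comment> \<open>The linear gain \<open>37/29 * e\<close> exceeds \<open>3 * e ^ 2\<close>. The
    resulting \<open>N \<le> Y\<close> makes the part \<open>s * N ^ 2\<close> of \<open>A\<close>
    at most \<open>s * (N * Y)\<close>.\<close>
  have "N \<le> p powr ((7/29 + e) * (2 - 3 * e))"
  proof (rule order_trans[OF N(2)], rule powr_mono)
    have "e * e \<le> e * (1/464)" using e by (intro mult_left_mono) auto
    moreover have "(7/29 + e) * (2 - 3 * e) = 14/29 + 37/29 * e - 3 * (e * e)"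
      by (simp add: field_simps)
    ultimately show "14/29 \<le> (7/29 + e) * (2 - 3 * e)" using e by linarith
  qed (use p in auto)
  also have "\<dots> \<le> r powr (2 - 3 * e)" using e by (intro powr_r) auto
  finally have NY: "N \<le> Y" using Y by simp
  then have Y0: "Y > 0" using N0 by simp
  define c where "c = (1 + s) ^ 6"
  have c: "c \<ge> 0" using s by (simp add: c_def)
  have big': "128 * c * C < p powr e" using big unfolding c_def .
  have "A \<le> (1 + s) * (N * Y)"
  proof -
    have "s * N ^ 2 \<le> s * (N * Y)"
      using NY N0 s by (intro mult_left_mono) (auto simp: power2_eq_square)
    then show ?thesis using A by (simp add: algebra_simps)
  qed
  then have A6: "A ^ 6 \<le> c * (N * Y) ^ 6"
    unfolding c_def power_mult_distrib[of "1 + s", symmetric] using A(1) by (rule power_mono)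
  have JC: "J * k \<le> C * r powr 10" using J r by simp
  have C0: "C \<ge> 0"
  proof -
    have "0 \<le> C * r ^ 10" using J k0 by (meson mult_nonneg_nonneg less_imp_le order_trans)
    then show ?thesis using r by (simp add: zero_le_mult_iff)
  qed
  have "J * r powr (1 - e) \<le> C * r powr 10" using k J(1) JC by (meson mult_left_mono order_trans)
  then have J_le: "J \<le> C * r powr (9 + e)"
  proof -
    have "r powr 10 = r powr (9 + e) * r powr (1 - e)" by (simp flip: powr_add)
    then have "J * r powr (1 - e) \<le> (C * r powr (9 + e)) * r powr (1 - e)"
      using \<open>J * r powr (1 - e) \<le> C * r powr 10\<close> by (simp add: mult_ac)
    then show ?thesis using r(1) by (simp add: mult_le_cancel_right)
  qed
  have Y12: "r powr (24 - 36 * e) \<le> Y ^ 12"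
  proof -
    have "r powr (24 - 36 * e) = (r powr (2 - 3 * e)) ^ 12"
      using r(1) by (simp add: powr_powr algebra_simps flip: powr_realpow)
    also have "\<dots> \<le> Y ^ 12" using Y by (intro power_mono) auto
    finally show ?thesis .
  qed
  \<comment> \<open>The 128 is \<open>2 ^ 7\<close>, from the factor 2 lost in the lower bound for
    \<open>N\<close>.\<close>
  have N7: "p powr (98/29) \<le> 128 * N ^ 7"
  proof -
    have "p powr (98/29) = (p powr (14/29)) ^ 7"
      using p by (simp add: powr_powr flip: powr_realpow)
    also have "\<dots> \<le> (2 * N) ^ 7" using N(1) by (intro power_mono) auto
    finally show ?thesis by (simp add: power_mult_distrib)
  qed
  \<comment> \<open>The exponent 15 of \<open>r\<close> is what the 24 from \<open>Y ^ 12\<close>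
    leaves beyond the 9 from \<open>J\<close>, and \<open>15 * 7/29 = 105/29\<close>. The linear
    gain \<open>176/29 * e\<close> covers both \<open>e\<close> and the quadratic term.\<close>
  have main: "p powr (105/29 + e) \<le> r powr (15 - 37 * e)"
  proof -
    have "e * e \<le> e * (1/464)" using e by (intro mult_left_mono) auto
    moreover have "(7/29 + e) * (15 - 37 * e) = 105/29 + 176/29 * e - 37 * (e * e)"
      by (simp add: field_simps)
    ultimately have "105/29 + e \<le> (7/29 + e) * (15 - 37 * e)" using e by linarith
    then have "p powr (105/29 + e) \<le> p powr ((7/29 + e) * (15 - 37 * e))"
      using p by (intro powr_mono) auto
    also have "\<dots> \<le> r powr (15 - 37 * e)" using e by (intro powr_r) auto
    finally show ?thesis .
  qed
  have 1: "128 * (c * p ^ 7 * J) \<le> (128 * c * C) * (p ^ 7 * r powr (9 + e))"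
  proof -
    have "(128 * c * p ^ 7) * J \<le> (128 * c * p ^ 7) * (C * r powr (9 + e))"
      using c p by (intro mult_left_mono J_le) auto
    then show ?thesis by (simp only: mult_ac)
  qed
  have 2: "(128 * c * C) * (p ^ 7 * r powr (9 + e)) < p powr e * (p ^ 7 * r powr (9 + e))"
  proof (rule mult_strict_right_mono[OF big'])
    have "0 < p ^ 7" "0 < r powr (9 + e)" using p r(1) by simp_all
    then show "0 < p ^ 7 * r powr (9 + e)" by (rule mult_pos_pos)
  qed
  \<comment> \<open>The split \<open>7 = 98/29 + 105/29\<close>: the first part is paid for by
    \<open>N ^ 7\<close>, the second by the surplus power of \<open>r\<close>.\<close>
  have 3: "p powr e * (p ^ 7 * r powr (9 + e)) = p powr (98/29) * (p powr (105/29 + e) * r powr (9 + e))"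
  proof -
    have "p ^ 7 = p powr 7" using p by simp
    then have "p powr e * p ^ 7 = p powr (98/29) * p powr (105/29 + e)"
      by (simp only: powr_add[symmetric]) (simp add: add.commute)
    then show ?thesis by (simp only: mult.assoc[symmetric])
  qed
  have 4: "p powr (98/29) * (p powr (105/29 + e) * r powr (9 + e)) \<le> p powr (98/29) * r powr (24 - 36 * e)"
  proof (rule mult_left_mono)
    have "p powr (105/29 + e) * r powr (9 + e) \<le> r powr (15 - 37 * e) * r powr (9 + e)"
      by (intro mult_right_mono main) simp
    then show "p powr (105/29 + e) * r powr (9 + e) \<le> r powr (24 - 36 * e)"
      by (simp flip: powr_add)
  qed simp
  have 5: "p powr (98/29) * r powr (24 - 36 * e) \<le> (128 * N ^ 7) * Y ^ 12"
    using N0 by (intro mult_mono N7 Y12) auto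
  have fin: "c * p ^ 7 * J < N ^ 7 * Y ^ 12"
    using 1 2 4 5 unfolding 3 by (simp only: mult.assoc)
  have 6: "N ^ 5 * p ^ 7 * J * A ^ 6 \<le> N ^ 5 * p ^ 7 * J * (c * (N * Y) ^ 6)"
    using N0 p J(1) by (intro mult_left_mono A6) simp
  have 7: "N ^ 5 * p ^ 7 * J * (c * (N * Y) ^ 6) = (N ^ 11 * Y ^ 6) * (c * p ^ 7 * J)"
  proof -
    have "N ^ 11 = N ^ 5 * N ^ 6" by (simp flip: power_add)
    then show ?thesis by (simp only: power_mult_distrib mult_ac)
  qed
  have 8: "(N ^ 11 * Y ^ 6) * (c * p ^ 7 * J) < (N ^ 11 * Y ^ 6) * (N ^ 7 * Y ^ 12)"
    using N0 Y0 by (intro mult_strict_left_mono[OF fin]) simp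
  have 9: "(N ^ 11 * Y ^ 6) * (N ^ 7 * Y ^ 12) = (N * Y) ^ 18"
  proof -
    have "N ^ 18 = N ^ 11 * N ^ 7" "Y ^ 18 = Y ^ 6 * Y ^ 12" by (simp_all flip: power_add)
    then show ?thesis by (simp only: power_mult_distrib mult_ac)
  qed
  show ?thesis using 6 8 unfolding 7 9 by (rule le_less_trans)
qed

theorem theorem1p1:
  fixes s :: nat and \<epsilon> :: real
  assumes "s > 0" and "\<epsilon> > 0"
  shows "\<exists>P :: nat. \<forall>p :: nat. prime p \<and> p \<ge> P \<longrightarrow>
    (\<forall>(M :: int set) (H :: int).
      M \<subseteq> {1..<int p} \<and> int (card M) = \<lfloor>real p powr (14/29)\<rfloor> \<and>
      H = \<lfloor>real p powr (14/29 + \<epsilon>)\<rfloor> \<longrightarrow>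
      (\<forall>l :: int. \<exists>m\<^sub>1 \<in> M. \<exists>m\<^sub>2 \<in> M. \<exists>m\<^sub>3 \<in> M. \<exists>x\<^sub>1 \<in> {1..H}. \<exists>x\<^sub>2 \<in> {1..H}. \<exists>x\<^sub>3 \<in> {1..H}.
        coprime x\<^sub>1 (int p) \<and> coprime x\<^sub>2 (int p) \<and> coprime x\<^sub>3 (int p) \<and>
        [residue_div p m\<^sub>1 (x\<^sub>1 ^ s) + residue_div p m\<^sub>2 (x\<^sub>2 ^ s)
          + residue_div p m\<^sub>3 (x\<^sub>3 ^ s) = l] (mod int p)))"
proof -
  \<comment> \<open>The elements of \<open>X\<close> are at most \<open>r p ^ 2\<close>, hence at
    most \<open>p powr (14/29 + 4 * e)\<close>, so \<open>4 * e \<le> \<epsilon>\<close> places them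
    in \<open>{1..H}\<close>.\<close>
  define e where "e = min (\<epsilon> / 4) (1/464)"
  have e: "0 < e" "e \<le> 1/464" "4 * e \<le> \<epsilon>" using assms by (auto simp: e_def)
  define r where "r = (\<lambda>p::nat. nat \<lfloor>real p powr (7/29 + 2 * e)\<rfloor>)"
  obtain P where P: "\<And>p. p \<ge> P \<Longrightarrow> r p \<ge> 2 \<and> 2 * r p ^ 3 < p \<and> r p ^ 4 < p \<and>
    real p powr (7/29 + e) \<le> real (r p) \<and>
    real (r p) powr (2 - 3 * e) \<le> real (prime_count (r p ^ 2)) - real (prime_count (r p)) \<and>
    real (r p) powr (1 - e) \<le> real (prime_count (r p)) \<and>
    128 * real (1 + s) ^ 6 * real (243 * (81 + 5 * s)) < real p powr e \<and>
    real p powr (14/29) \<ge> 2"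
    using eventually_parameters[OF e(1,2), of s] unfolding r_def eventually_sequentially by blast
  show ?thesis
  proof (intro exI[of _ P] allI impI; elim conjE)
    fix p :: nat and M :: "int set" and H l :: int
    assume p: "prime p" and "p \<ge> P" and M: "M \<subseteq> {1..<int p}"
      and card_M: "int (card M) = \<lfloor>real p powr (14/29)\<rfloor>" and H: "H = \<lfloor>real p powr (14/29 + \<epsilon>)\<rfloor>"
    note P = P[OF \<open>p \<ge> P\<close>]
    have p1: "p > 1" using p prime_gt_1_nat by blast
    define X where "X = {q::int. prime q \<and> q \<le> int (r p ^ 2) \<and> int (r p) < q}"
    have finX: "finite X"
      by (rule finite_subset[of _ "{q. prime q \<and> q \<le> int (r p ^ 2)}"]) (auto simp: X_def)
    have X_bounds: "1 < x" "x \<le> int (r p ^ 2)" if "x \<in> X" for x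
      using that prime_gt_1_int by (auto simp: X_def)
    have r24: "int (r p ^ 2) * int (r p ^ 2) < int p"
      using P by (simp flip: power_add of_nat_mult)
    have XX: "x * y < int p" if "x \<in> X" "y \<in> X" for x y
    proof -
      have "x * y \<le> int (r p ^ 2) * int (r p ^ 2)"
        using X_bounds[OF that(1)] X_bounds[OF that(2)] by (intro mult_mono) auto
      then show ?thesis using r24 by linarith
    qed
    have card_X: "real (card X) \<ge> real (prime_count (r p ^ 2)) - real (prime_count (r p))"
    proof -
      have "{q. prime q \<and> q \<le> int (r p ^ 2)} \<subseteq> X \<union> {q. prime q \<and> q \<le> int (r p)}"
        by (auto simp: X_def)
      then have "card {q. prime q \<and> q \<le> int (r p ^ 2)} \<le> card (X \<union> {q. prime q \<and> q \<le> int (r p)})"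
        using finX by (intro card_mono) auto
      also have "\<dots> \<le> card X + card {q. prime q \<and> q \<le> int (r p)}" by (rule card_Un_le)
      finally show ?thesis unfolding card_int_primes by linarith
    qed
    define J where "J = energy p (sum3 (inv_pow p s)) (X \<times> X \<times> X)"
    define A where "A = energy p (\<lambda>(m, x). m * inv_pow p s x) (M \<times> X)"
    have J: "J * prime_count (r p) \<le> 243 * (81 + 5 * s) * r p ^ 10"
      unfolding J_def X_def using P assms by (intro energy_prime_powers_le[OF p]) auto
    have A: "A \<le> card M * card X + s * card M ^ 2"
      unfolding A_def using XX
      by (intro energy_prime_quotients_le[OF p assms(1) M finX]) (auto simp: X_def)
    have "real (card M) ^ 5 * real p ^ 7 * real J * real A ^ 6 < (real (card M) * real (card X)) ^ 18"
    proof (rule parameter_inequality[of "real p" e "real (r p)" "real (prime_count (r p))" _ _ _ "real (243 * (81 + 5 * s))" _ "real s"])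
      show "real p powr (14/29) / 2 \<le> real (card M)" "real (card M) \<le> real p powr (14/29)"
        using card_M P by linarith+
      show "real J * real (prime_count (r p)) \<le> real (243 * (81 + 5 * s)) * real (r p) ^ 10"
        using J unfolding of_nat_power[symmetric] of_nat_mult[symmetric] of_nat_le_iff .
      show "real A \<le> real (card M) * real (card X) + real s * real (card M) ^ 2"
        using A unfolding of_nat_power[symmetric] of_nat_mult[symmetric] of_nat_add[symmetric] of_nat_le_iff .
    qed (use P p1 e card_X in auto)
    then have less: "card M ^ 5 * p ^ 7 * J * A ^ 6 < (card M * card X) ^ 18"
      unfolding of_nat_power[symmetric] of_nat_mult[symmetric] of_nat_less_iff .
    obtain m1 m2 m3 x1 x2 x3 where mx: "m1 \<in> M" "m2 \<in> M" "m3 \<in> M" "x1 \<in> X" "x2 \<in> X" "x3 \<in> X"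
      and sol: "[m1 * inv_pow p s x1 + m2 * inv_pow p s x2 + m3 * inv_pow p s x3 = l] (mod int p)"
      using ternary_representation[OF p M finX, of "inv_pow p s" l] less unfolding J_def A_def by blast
    have XH: "x \<in> {1..H}" if "x \<in> X" for x
    proof -
      have "real (r p) \<le> real p powr (7/29 + 2 * e)" by (simp add: r_def)
      then have "real (r p) ^ 2 \<le> (real p powr (7/29 + 2 * e)) ^ 2" by (intro power_mono) auto
      also have "\<dots> = real p powr (14/29 + 4 * e)"
        using p1 by (simp add: powr_powr algebra_simps flip: powr_realpow)
      also have "\<dots> \<le> real p powr (14/29 + \<epsilon>)" using e p1 by (intro powr_mono) auto
      finally have "int (r p ^ 2) \<le> H" unfolding H by (simp add: le_floor_iff)
      then show ?thesis using X_bounds[OF that] by auto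
    qed
    have Xcop: "coprime x (int p)" if "x \<in> X" for x
    proof -
      have "x * 1 \<le> x * x" using X_bounds[OF that] by (intro mult_left_mono) auto
      then have "x < int p" using XX[OF that that] by linarith
      then show ?thesis
        using X_bounds[OF that] zdvd_imp_le[of "int p" x] by (auto simp: coprime_prime_int_iff[OF p])
    qed
    have residue_div: "[residue_div p m (x ^ s) = m * inv_pow p s x] (mod int p)" for m x
      by (simp add: residue_div_def inv_pow_def Cong.cong_def)
    have "[residue_div p m1 (x1 ^ s) + residue_div p m2 (x2 ^ s) + residue_div p m3 (x3 ^ s) = l] (mod int p)"
      by (rule cong_trans[OF cong_add[OF cong_add[OF residue_div residue_div] residue_div] sol])
    then show "\<exists>m\<^sub>1 \<in> M. \<exists>m\<^sub>2 \<in> M. \<exists>m\<^sub>3 \<in> M. \<exists>x\<^sub>1 \<in> {1..H}. \<exists>x\<^sub>2 \<in> {1..H}. \<exists>x\<^sub>3 \<in> {1..H}.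
        coprime x\<^sub>1 (int p) \<and> coprime x\<^sub>2 (int p) \<and> coprime x\<^sub>3 (int p) \<and>
        [residue_div p m\<^sub>1 (x\<^sub>1 ^ s) + residue_div p m\<^sub>2 (x\<^sub>2 ^ s)
          + residue_div p m\<^sub>3 (x\<^sub>3 ^ s) = l] (mod int p)"
      using mx XH Xcop by blast
  qed
qed

end
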